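(* Let $p$ be a prime number and $n,k,s$ positive integers with $s\geq 2$ and $n\geq (p+s-2)(k-1)+\max(\{p,s\})$. Then $$\chi\left(KG^{p}(n,k)_{\widetilde{s\text{-}stab}}\right)\geq \left\lceil \frac{n-(p+s-2)(k-1)}{p-1}\right\rceil .$$
   Context: A $k$-subset $S\subseteq[n]$ is almost $s$-stable if $|i-j|\geq s$ for all distinct $i,j\in S$. $KG^{p}(n,k)_{\widetilde{s\text{-}stab}}$ is the $p$-uniform hypergraph whose vertices are the almost $s$-stable $k$-subsets of $[n]$ and whose edges are the $p$-element sets of pairwise disjoint such subsets. A proper coloring of a hypergraph assigns colors to vertices so that no edge is monochromatic; $\chi$ is the minimum number of colors in a proper coloring. *)

theory Defs
  imports Complex_Main "HOL-Computational_Algebra.Primes"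
begin

definition monochromatic :: "('a \<Rightarrow> 'c) \<Rightarrow> 'a set \<Rightarrow> bool" where
  "monochromatic f e \<longleftrightarrow> (\<exists>c. \<forall>v\<in>e. f v = c)"

definition proper_coloring :: "'a set \<Rightarrow> 'a set set \<Rightarrow> nat \<Rightarrow> ('a \<Rightarrow> nat) \<Rightarrow> bool" where
  "proper_coloring V E m f \<longleftrightarrow> f ` V \<subseteq> {..<m} \<and> (\<forall>e\<in>E. \<not> monochromatic f e)"

text \<open>The least element is only meaningful if some proper coloring with finitely many colors
  exists; \<open>properly_colorable\<close> below covers every finite hypergraph all of whose edges
  have at least two vertices.\<close>

definition chromatic_number :: "'a set \<Rightarrow> 'a set set \<Rightarrow> nat" where
  "chromatic_number V E = (LEAST m. \<exists>f. proper_coloring V E m f)"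

definition almost_stable :: "nat \<Rightarrow> nat set \<Rightarrow> bool" where
  "almost_stable s S \<longleftrightarrow> (\<forall>i\<in>S. \<forall>j\<in>S. i \<noteq> j \<longrightarrow> \<bar>int i - int j\<bar> \<ge> int s)"

definition KG_vertices :: "nat \<Rightarrow> nat \<Rightarrow> nat \<Rightarrow> nat set set" where
  "KG_vertices n k s = {S. S \<subseteq> {1..n} \<and> card S = k \<and> almost_stable s S}"

definition KG_edges :: "nat \<Rightarrow> nat \<Rightarrow> nat \<Rightarrow> nat \<Rightarrow> nat set set set" where
  "KG_edges p n k s = {e. e \<subseteq> KG_vertices n k s \<and> card e = p \<and> pairwise disjnt e}"

lemma properly_colorable:
  assumes "finite V" and "\<And>e. e \<in> E \<Longrightarrow> e \<subseteq> V" and "\<And>e. e \<in> E \<Longrightarrow> card e \<ge> 2"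
  shows "\<exists>f. proper_coloring V E (card V) f"
proof -
  obtain f where f: "bij_betw f V {..<card V}"
    using \<open>finite V\<close> ex_bij_betw_finite_nat[of V] by (auto simp: atLeast0LessThan)
  have "\<not> monochromatic f e" if "e \<in> E" for e
  proof
    assume "monochromatic f e"
    then obtain c where c: "\<forall>v\<in>e. f v = c" by (auto simp: monochromatic_def)
    have "inj_on f e"
      using f assms(2)[OF that] by (auto simp: bij_betw_def intro: inj_on_subset)
    then have "card e = card (f ` e)" by (simp add: card_image)
    also have "\<dots> \<le> card {c}" using c by (intro card_mono) auto
    finally show False using assms(3)[OF that] by simp
  qed
  then show ?thesis using f by (auto simp: proper_coloring_def bij_betw_def)
qed

lemma KG_properly_colorable:
  assumes "p \<ge> 2"
  shows "\<exists>m f. proper_coloring (KG_vertices n k s) (KG_edges p n k s) m f"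
proof -
  have "KG_vertices n k s \<subseteq> Pow {1..n}" by (auto simp: KG_vertices_def)
  then have "finite (KG_vertices n k s)" by (rule finite_subset) simp
  then show ?thesis
    using properly_colorable[of "KG_vertices n k s" "KG_edges p n k s"] assms
    by (auto simp: KG_edges_def)
qed

end

theory Submission
  imports Defs "HOL-Number_Theory.Cong"
begin

text \<open>A proper coloring with \<open>C\<close> colors yields an equivariant labelling of the nonzero vectors
  \<open>Y \<in> (Z\<^sub>p \<union> {0})\<^sup>n\<close>, and the labels are then counted by a \<open>Z\<^sub>p\<close>-Tucker lemma. Let
  \<open>g\<^sub>i\<close> be the largest size of an almost \<open>s\<close>-stable set in the \<open>i\<close>-th sign class of \<open>Y\<close>.
  If some \<open>g\<^sub>i \<ge> k\<close>, the label is the number of pairs (sign class, color of a vertex inside it); no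
  color occurs in all \<open>p\<close> classes, so at most \<open>C (p - 1)\<close> such labels are needed. Otherwise the label
  is \<open>\<Sum> g\<^sub>i\<close>, at most \<open>p (k - 1)\<close>. In both cases a sign can be chosen equivariantly from the data,
  because \<open>p\<close> is prime, unless all \<open>g\<^sub>i\<close> are equal. In this exceptional case the sign is that of the
  first nonzero position, and the residue of this position modulo \<open>s - 1\<close> refines the label, at the cost
  of \<open>s - 2\<close> extra labels for each of \<open>k - 1\<close> values: if enlarging \<open>Y\<close> moves the first
  position down by at least \<open>s - 1\<close> and changes its sign, the new first element extends an
  almost stable set of its class.

  The Tucker lemma is proved with integral simplicial chains. The join of \<open>n\<close> copies of \<open>Z\<^sub>p\<close>
  carries chains \<open>h\<^sub>k\<close> whose boundaries are alternately \<open>(T - 1) h\<close> and \<open>(1 + T + \<dots> + T\<^bsup>p-1\<^esup>) h\<close>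
  for the preceding chain \<open>h\<close>.
  A labelling with fewer than \<open>n\<close> levels would map \<open>h\<^sub>n\<close> to \<open>0\<close>; freeness of the action then lets one
  descend to \<open>p\<close> dividing \<open>1\<close>.\<close>

section \<open>Chains on the join of copies of a cyclic group\<close>

text \<open>Signs are the numbers below \<open>p\<close>; fixing all larger numbers makes \<open>rot p\<close> a permutation
  of order dividing \<open>p\<close> on the whole type. Signed vectors are partial maps from positions to signs.\<close>

definition rot :: "nat \<Rightarrow> nat \<Rightarrow> nat" where
  "rot p i = (if i < p then Suc i mod p else i)"

definition shift :: "nat \<Rightarrow> (nat \<rightharpoonup> nat) \<Rightarrow> (nat \<rightharpoonup> nat)" where
  "shift p F = map_option (rot p) \<circ> F"

text \<open>The signed vectors of length \<open>n\<close> are also the faces (including the empty one) of the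
  \<open>n\<close>-fold join of \<open>Z\<^sub>p\<close>, ordered by position, so that rotation preserves orientations.\<close>

definition faces :: "nat \<Rightarrow> nat \<Rightarrow> (nat \<rightharpoonup> nat) set" where
  "faces p n = {F. dom F \<subseteq> {..<n} \<and> ran F \<subseteq> {..<p}}"

lemma rot_less [simp]: "rot p i < p \<longleftrightarrow> i < p"
  by (auto simp: rot_def)

lemma rot_pow: "i < p \<Longrightarrow> (rot p ^^ j) i = (i + j) mod p"
  by (induction j) (auto simp: rot_def mod_Suc_eq)

lemma rot_pow_ge: "i \<ge> p \<Longrightarrow> (rot p ^^ j) i = i"
  by (induction j) (auto simp: rot_def)

lemma rot_pow_p: "rot p ^^ p = id"
  by (rule ext) (metis id_apply linorder_not_less mod_add_self2 mod_less rot_pow rot_pow_ge)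

lemma inj_rot: "inj (rot p)"
proof (cases p)
  case 0
  then show ?thesis by (simp add: rot_def inj_def)
next
  case (Suc q)
  then have "(rot p ^^ q) \<circ> rot p = id"
    using rot_pow_p[of p] by (simp only: funpow_Suc_right)
  then show ?thesis by (metis inj_on_id inj_on_imageI2)
qed

lemma bij_betw_rot: "bij_betw (rot p) {..<p} {..<p}"
  unfolding bij_betw_def
proof
  show i: "inj_on (rot p) {..<p}" using inj_rot inj_on_subset by blast
  show "rot p ` {..<p} = {..<p}"
    by (rule endo_inj_surj) (use i in auto)
qed

lemma dom_shift [simp]: "dom (shift p F) = dom F"
  by (auto simp: shift_def)

lemma shift_eq_None [simp]: "shift p F l = None \<longleftrightarrow> F l = None"
  by (simp add: shift_def)

lemma shift_eq_empty [simp]: "shift p F = Map.empty \<longleftrightarrow> F = Map.empty"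
  by (simp add: fun_eq_iff)

lemma shift_pow: "(shift p ^^ j) F = map_option (rot p ^^ j) \<circ> F"
  by (induction j) (simp_all add: option.map_ident option.map_comp fun_eq_iff shift_def o_def)

lemma shift_pow_p [simp]: "(shift p ^^ p) F = F"
  by (simp add: shift_pow rot_pow_p option.map_id0)

lemma inj_shift: "inj (shift p)"
  by (rule injI, rule ext) 
    (metis (no_types, lifting) comp_apply inj_rot injD option.inj_map shift_def)

lemma ran_shift: "ran (shift p F) = rot p ` ran F"
  by (force simp: ran_def shift_def)

lemma shift_faces [simp]: "shift p F \<in> faces p n \<longleftrightarrow> F \<in> faces p n"
  by (auto simp: faces_def ran_shift)

lemma shift_pow_faces [simp]: "(shift p ^^ j) F \<in> faces p n \<longleftrightarrow> F \<in> faces p n"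
  by (induction j) auto

lemma dom_shift_pow [simp]: "dom ((shift p ^^ j) F) = dom F"
  by (induction j) auto

lemma shift_upd: "shift p (F(l \<mapsto> i)) = (shift p F)(l \<mapsto> rot p i)"
  by (auto simp: shift_def)

lemma shift_del: "shift p (F(l := None)) = (shift p F)(l := None)"
  by (auto simp: shift_def)

lemma finite_faces [simp]: "finite (faces p n)"
proof -
  have "faces p n \<subseteq> (\<Union>A\<in>Pow {..<n}. {F. dom F = A \<and> ran F \<subseteq> {..<p}})"
    by (auto simp: faces_def)
  then show ?thesis
    by (rule finite_subset) (auto intro!: finite_set_of_finite_maps finite_subset[of _ "{..<n}"])
qed

lemma finite_dom_faces: "F \<in> faces p n \<Longrightarrow> finite (dom F)"
  by (auto simp: faces_def intro: finite_subset)

lemma faces_upd: "F \<in> faces p n \<Longrightarrow> l < n \<Longrightarrow> i < p \<Longrightarrow> F(l \<mapsto> i) \<in> faces p n"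
  by (auto simp: faces_def ran_def split: if_splits)

lemma faces_del: "F \<in> faces p n \<Longrightarrow> F(l := None) \<in> faces p n"
  by (auto simp: faces_def ran_def split: if_splits)

lemma card_dom_del: "m \<in> dom Y \<Longrightarrow> card (dom Y) = Suc k \<Longrightarrow> card (dom (Y(m := None))) = k"
  by (simp add: card_Diff_singleton)

section \<open>Boundary, cone and rotation operators on chains\<close>

definition sg :: "(nat \<rightharpoonup> nat) \<Rightarrow> nat \<Rightarrow> int" where
  "sg F l = (-1) ^ card (dom F \<inter> {..<l})"

text \<open>Chains are coefficient functions, so the boundary coefficient at \<open>F\<close>
  gathers all faces with one more vertex. The empty face takes part: the complex is
  augmented.\<close>

definition bd :: "nat \<Rightarrow> nat \<Rightarrow> ((nat \<rightharpoonup> nat) \<Rightarrow> int) \<Rightarrow> (nat \<rightharpoonup> nat) \<Rightarrow> int" where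
  "bd p n z F = (\<Sum>l\<in>{..<n} - dom F. \<Sum>i<p. sg F l * z (F(l \<mapsto> i)))"

text \<open>The cone whose apex, sign \<open>i\<close> at position \<open>l\<close>, is written
  first; \<open>sg F l\<close> moves it to its ordered place. Faces of \<open>z\<close> that already
  occupy position \<open>l\<close> contribute nothing.\<close>

definition wedge :: "nat \<Rightarrow> nat \<Rightarrow> ((nat \<rightharpoonup> nat) \<Rightarrow> int) \<Rightarrow> (nat \<rightharpoonup> nat) \<Rightarrow> int" where
  "wedge l i z F = (if F l = Some i then sg F l * z (F(l := None)) else 0)"

definition empty_chain :: "(nat \<rightharpoonup> nat) \<Rightarrow> int" where
  "empty_chain F = of_bool (F = Map.empty)"

definition diff_op :: "nat \<Rightarrow> ((nat \<rightharpoonup> nat) \<Rightarrow> int) \<Rightarrow> (nat \<rightharpoonup> nat) \<Rightarrow> int" where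
  "diff_op p z F = z (shift p F) - z F"

definition norm_op :: "nat \<Rightarrow> ((nat \<rightharpoonup> nat) \<Rightarrow> int) \<Rightarrow> (nat \<rightharpoonup> nat) \<Rightarrow> int" where
  "norm_op p z F = (\<Sum>j<p. z ((shift p ^^ j) F))"

text \<open>The degree \<open>k\<close> is the number of vertices, one more than the dimension.\<close>

definition homog :: "nat \<Rightarrow> nat \<Rightarrow> nat \<Rightarrow> ((nat \<rightharpoonup> nat) \<Rightarrow> int) \<Rightarrow> bool" where
  "homog p n k z \<longleftrightarrow> (\<forall>F. z F \<noteq> 0 \<longrightarrow> F \<in> faces p n \<and> card (dom F) = k)"

lemma sg_sq [simp]: "sg F l * sg F l = 1"
  by (simp add: sg_def power_add[symmetric] mult_2[symmetric])

lemma sg_shift [simp]: "sg (shift p F) l = sg F l"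
  by (simp add: sg_def)

lemma sg_upd_same [simp]: "sg (F(l := x)) l = sg F l"
proof -
  have "dom (F(l := x)) \<inter> {..<l} = dom F \<inter> {..<l}" by (auto split: if_splits)
  then show ?thesis by (simp add: sg_def)
qed

lemma sg_upd_None:
  assumes "l \<notin> dom F"
  shows "sg (F(l \<mapsto> i)) m = (if l < m then - sg F m else sg F m)"
proof -
  have "dom (F(l \<mapsto> i)) \<inter> {..<m} = (if l < m then insert l (dom F \<inter> {..<m}) else dom F \<inter> {..<m})"
    by auto
  then show ?thesis using assms by (simp add: sg_def)
qed

lemma sg_del:
  assumes "l \<in> dom F"
  shows "sg (F(l := None)) m = (if l < m then - sg F m else sg F m)"
proof -
  from assms obtain i where i: "F l = Some i" by auto
  have *: "(F(l := None))(l \<mapsto> i) = F" using i by (simp add: fun_upd_idem)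
  have "sg F m = (if l < m then - sg (F(l := None)) m else sg (F(l := None)) m)"
    using sg_upd_None[of l "F(l := None)" i m] unfolding * by simp
  then show ?thesis by simp
qed

lemma sum_antisym:
  fixes g :: "'a \<Rightarrow> 'a \<Rightarrow> int"
  assumes "\<And>a b. a \<in> A \<Longrightarrow> b \<in> A \<Longrightarrow> g a b = - g b a"
  shows "(\<Sum>a\<in>A. \<Sum>b\<in>A. g a b) = 0"
proof -
  have "(\<Sum>a\<in>A. \<Sum>b\<in>A. g a b) = (\<Sum>b\<in>A. \<Sum>a\<in>A. g a b)" by (rule sum.swap)
  also have "\<dots> = (\<Sum>b\<in>A. \<Sum>a\<in>A. - g b a)" by (intro sum.cong refl) (rule assms)
  also have "\<dots> = - (\<Sum>a\<in>A. \<Sum>b\<in>A. g a b)" by (simp add: sum_negf)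
  finally show ?thesis by simp
qed

lemma bd_bd [simp]: "bd p n (bd p n z) F = 0"
proof -
  \<comment> \<open>Padding with zeros on the diagonal lets both indices run over the same set, so
    that the antisymmetry in \<open>l\<close> and \<open>m\<close> can cancel the whole sum.\<close>
  define g where "g l m = (if l = m then 0 else
    (\<Sum>i<p. \<Sum>j<p. sg F l * sg (F(l \<mapsto> i)) m * z (F(l \<mapsto> i, m \<mapsto> j))))" for l m
  have "bd p n (bd p n z) F = (\<Sum>l\<in>{..<n} - dom F. \<Sum>m\<in>{..<n} - dom F. g l m)"
    unfolding bd_def
  proof (rule sum.cong[OF refl])
    fix l assume l: "l \<in> {..<n} - dom F"
    have "(\<Sum>i<p. sg F l * (\<Sum>m\<in>{..<n} - dom (F(l \<mapsto> i)). \<Sum>j<p. 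
            sg (F(l \<mapsto> i)) m * z (F(l \<mapsto> i, m \<mapsto> j)))) =
      (\<Sum>i<p. \<Sum>m\<in>{..<n} - insert l (dom F). \<Sum>j<p. 
            sg F l * sg (F(l \<mapsto> i)) m * z (F(l \<mapsto> i, m \<mapsto> j)))"
      by (simp add: sum_distrib_left mult.assoc)
    also have "\<dots> = (\<Sum>m\<in>{..<n} - insert l (dom F). \<Sum>i<p. \<Sum>j<p. 
            sg F l * sg (F(l \<mapsto> i)) m * z (F(l \<mapsto> i, m \<mapsto> j)))"
      by (rule sum.swap)
    also have "\<dots> = (\<Sum>m\<in>{..<n} - insert l (dom F). g l m)"
      by (rule sum.cong) (auto simp: g_def)
    also have "\<dots> = (\<Sum>m\<in>{..<n} - dom F. g l m)"
      by (rule sum.mono_neutral_left) (auto simp: g_def)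
    finally show "(\<Sum>i<p. sg F l * (\<Sum>m\<in>{..<n} - dom (F(l \<mapsto> i)). \<Sum>j<p. 
            sg (F(l \<mapsto> i)) m * z (F(l \<mapsto> i, m \<mapsto> j)))) = (\<Sum>m\<in>{..<n} - dom F. g l m)" .
  qed
  also have "\<dots> = 0"
  proof (rule sum_antisym)
    fix l m assume lm: "l \<in> {..<n} - dom F" "m \<in> {..<n} - dom F"
    show "g l m = - g m l"
    proof (cases "l = m")
      case False
      have "g l m = (\<Sum>j<p. \<Sum>i<p. sg F l * sg (F(l \<mapsto> i)) m * z (F(l \<mapsto> i, m \<mapsto> j)))"
        using False by (simp add: g_def) (rule sum.swap)
      also have "\<dots> = (\<Sum>j<p. \<Sum>i<p. - (sg F m * sg (F(m \<mapsto> j)) l * z (F(m \<mapsto> j, l \<mapsto> i))))"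
        using False lm
        by (intro sum.cong refl) (simp add: sg_upd_None fun_upd_twist[of l m] domIff)
      also have "\<dots> = - g m l" using False by (simp add: g_def sum_negf)
      finally show ?thesis .
    qed (simp add: g_def)
  qed
  finally show ?thesis .
qed

lemma bd_empty_chain [simp]: "bd p n empty_chain F = 0"
  by (auto simp: bd_def empty_chain_def intro!: sum.neutral)

lemma bd_shift: "bd p n (\<lambda>F. z (shift p F)) F = bd p n z (shift p F)"
proof -
  have "(\<Sum>i<p. sg F l * z ((shift p F)(l \<mapsto> rot p i))) = (\<Sum>i<p. sg F l * z ((shift p F)(l \<mapsto> i)))" for l
    by (rule sum.reindex_bij_betw[OF bij_betw_rot])
  then show ?thesis by (simp add: bd_def shift_upd)
qed

lemma bd_shift_pow: "bd p n (\<lambda>F. z ((shift p ^^ j) F)) F = bd p n z ((shift p ^^ j) F)"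
proof (induction j arbitrary: F)
  case (Suc j)
  then show ?case
    using bd_shift[of p n "\<lambda>F. z ((shift p ^^ j) F)" F] by (simp add: funpow_swap1)
qed simp

lemma bd_diff: "bd p n (\<lambda>F. y F - z F) F = bd p n y F - bd p n z F"
  by (simp add: bd_def sum_subtractf right_diff_distrib)

lemma bd_add: "bd p n (\<lambda>F. y F + z F) F = bd p n y F + bd p n z F"
  by (simp add: bd_def sum.distrib distrib_left)

lemma bd_sum: "bd p n (\<lambda>F. \<Sum>a\<in>A. c a * f a F) F = (\<Sum>a\<in>A. c a * bd p n (f a) F)"
proof -
  have "bd p n (\<lambda>F. \<Sum>a\<in>A. c a * f a F) F =
      (\<Sum>l\<in>{..<n} - dom F. \<Sum>i<p. \<Sum>a\<in>A. c a * (sg F l * f a (F(l \<mapsto> i))))"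
    by (simp add: bd_def sum_distrib_left mult_ac)
  also have "\<dots> = (\<Sum>l\<in>{..<n} - dom F. \<Sum>a\<in>A. \<Sum>i<p. c a * (sg F l * f a (F(l \<mapsto> i))))"
    by (intro sum.cong refl) (rule sum.swap)
  also have "\<dots> = (\<Sum>a\<in>A. \<Sum>l\<in>{..<n} - dom F. \<Sum>i<p. c a * (sg F l * f a (F(l \<mapsto> i))))"
    by (rule sum.swap)
  finally show ?thesis by (simp add: bd_def sum_distrib_left)
qed

lemma bd_diff_op: "bd p n (diff_op p z) F = diff_op p (bd p n z) F"
proof -
  have "bd p n (diff_op p z) F = bd p n (\<lambda>F. z (shift p F) - z F) F"
    by (simp add: diff_op_def[abs_def])
  then show ?thesis by (simp add: bd_diff bd_shift diff_op_def)
qed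

lemma bd_norm_op: "bd p n (norm_op p z) F = norm_op p (bd p n z) F"
  using bd_sum[of p n "\<lambda>_. 1" "\<lambda>j F. z ((shift p ^^ j) F)" "{..<p}" F]
  by (simp add: norm_op_def[abs_def] bd_shift_pow)

text \<open>This is the cone formula. A face of \<open>z\<close> through the apex is dropped on the
  left, and its two contributions on the right cancel; \<open>compat\<close> excludes faces with
  another sign at position \<open>l\<close>.\<close>

lemma bd_wedge:
  assumes "l < n" "i < p"
    and compat: "\<And>F j. z F \<noteq> 0 \<Longrightarrow> F l = Some j \<Longrightarrow> j = i"
  shows "bd p n (wedge l i z) F = z F - wedge l i (bd p n z) F"
proof (cases "F l")
  case None
  have "(\<Sum>j<p. sg F m * wedge l i z (F(m \<mapsto> j))) = (if m = l then z F else 0)"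
    if "m \<in> {..<n} - dom F" for m
  proof (cases "m = l")
    case True
    have "(\<Sum>j<p. sg F m * wedge l i z (F(m \<mapsto> j))) = (\<Sum>j<p. if j = i then z F else 0)"
      using True None by (intro sum.cong refl) (auto simp: wedge_def fun_upd_idem mult.assoc[symmetric])
    then show ?thesis using True \<open>i < p\<close> by simp
  next
    case False
    then show ?thesis using None by (simp add: wedge_def)
  qed
  then have "bd p n (wedge l i z) F = (\<Sum>m\<in>{..<n} - dom F. if m = l then z F else 0)"
    by (simp add: bd_def)
  also have "\<dots> = z F" using None \<open>l < n\<close> by (simp add: sum.delta domIff)
  finally show ?thesis using None by (simp add: wedge_def)
next
  case (Some j)
  show ?thesis
  proof (cases "j = i")
    case False
    then have "z F = 0" using compat[of F j] Some by blast
    moreover have "wedge l i z (F(m \<mapsto> a)) = 0" if "m \<notin> dom F" for m a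
      using Some that False by (auto simp: wedge_def)
    ultimately show ?thesis using Some False by (simp add: wedge_def bd_def)
  next
    case True
    define G where "G = F(l := None)"
    have FG: "G(l \<mapsto> i) = F" using Some True by (simp add: G_def fun_upd_idem)
    have sgl: "sg G l = sg F l" by (simp add: G_def)
    have dG: "{..<n} - dom G = insert l ({..<n} - dom F)" 
      using Some \<open>l < n\<close> by (auto simp: G_def)
    have z0: "sg G l * z (G(l \<mapsto> a)) = (if a = i then sg F l * z F else 0)" for a
      using compat[of "G(l \<mapsto> a)" a] FG by (cases "z (G(l \<mapsto> a)) = 0") (auto simp: sgl)
    have "wedge l i (bd p n z) F = sg F l * (\<Sum>m\<in>insert l ({..<n} - dom F). \<Sum>a<p. sg G m * z (G(m \<mapsto> a)))"
      using Some True by (simp only: wedge_def bd_def dG G_def[symmetric] if_True simp_thms)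
    also have "(\<Sum>m\<in>insert l ({..<n} - dom F). \<Sum>a<p. sg G m * z (G(m \<mapsto> a))) =
        (\<Sum>a<p. sg G l * z (G(l \<mapsto> a))) + (\<Sum>m\<in>{..<n} - dom F. \<Sum>a<p. sg G m * z (G(m \<mapsto> a)))"
      using Some by (subst sum.insert) auto
    also have "(\<Sum>a<p. sg G l * z (G(l \<mapsto> a))) = sg F l * z F"
      unfolding z0 using \<open>i < p\<close> by simp
    finally have 1: "wedge l i (bd p n z) F = z F + 
        (\<Sum>m\<in>{..<n} - dom F. \<Sum>a<p. sg F l * (sg G m * z (G(m \<mapsto> a))))"
      by (simp only: distrib_left sum_distrib_left mult.assoc[symmetric] sg_sq mult_1)
    have "bd p n (wedge l i z) F = 
        (\<Sum>m\<in>{..<n} - dom F. \<Sum>a<p. - (sg F l * (sg G m * z (G(m \<mapsto> a)))))"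
      unfolding bd_def
    proof (intro sum.cong refl)
      fix m a assume m: "m \<in> {..<n} - dom F"
      then have ml: "m \<noteq> l" using Some by auto
      have u: "(F(m \<mapsto> a))(l := None) = G(m \<mapsto> a)" using ml by (simp add: G_def fun_upd_twist)
      \<comment> \<open>Exactly one of the two signs sees the other position below it, whichever of
        \<open>m\<close> and \<open>l\<close> is smaller.\<close>
      have "sg F m * sg (F(m \<mapsto> a)) l = - (sg F l * sg G m)"
        using m ml sg_upd_None[of m F a l] sg_del[of l F m] Some unfolding G_def by (cases "m < l") (simp_all add: domIff)
      then show "sg F m * wedge l i z (F(m \<mapsto> a)) = - (sg F l * (sg G m * z (G(m \<mapsto> a))))"
        using Some True ml u by (simp add: wedge_def mult.assoc[symmetric])
    qed
    then show ?thesis unfolding 1 by (simp only: sum_negf)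
  qed
qed

section \<open>Freeness of the rotation\<close>

lemma homog_face: "homog p n k z \<Longrightarrow> z F \<noteq> 0 \<Longrightarrow> F \<in> faces p n"
  by (simp add: homog_def)

lemma homog_card: "homog p n k z \<Longrightarrow> z F \<noteq> 0 \<Longrightarrow> card (dom F) = k"
  by (simp add: homog_def)

lemma homog_mono: "homog p m k z \<Longrightarrow> m \<le> n \<Longrightarrow> homog p n k z"
  by (force simp: homog_def faces_def)

lemma homog_zero: "homog p n k (\<lambda>F. 0)"
  by (simp add: homog_def)

lemma homog_diff: "homog p n k y \<Longrightarrow> homog p n k z \<Longrightarrow> homog p n k (\<lambda>F. y F - z F)"
  unfolding homog_def by (metis diff_0_right)

lemma homog_shift_pow: "homog p n k z \<Longrightarrow> homog p n k (\<lambda>F. z ((shift p ^^ j) F))"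
  unfolding homog_def by (metis dom_shift_pow shift_pow_faces)

lemma homog_sum: "(\<And>a. a \<in> A \<Longrightarrow> homog p n k (f a)) \<Longrightarrow> homog p n k (\<lambda>F. \<Sum>a\<in>A. f a F)"
  unfolding homog_def by (meson sum.neutral)

lemma homog_diff_op: "homog p n k z \<Longrightarrow> homog p n k (diff_op p z)"
  using homog_diff[OF homog_shift_pow[of p n k z 1], of z] by (simp add: diff_op_def[abs_def])

lemma homog_norm_op: "homog p n k z \<Longrightarrow> homog p n k (norm_op p z)"
  unfolding norm_op_def[abs_def] by (intro homog_sum homog_shift_pow)

lemma homog_bd:
  assumes "homog p n (Suc k) z"
  shows "homog p n k (bd p n z)"
  unfolding homog_def
proof (intro allI impI)
  fix F assume "bd p n z F \<noteq> 0"
  then obtain l i where l: "l \<in> {..<n} - dom F" "z (F(l \<mapsto> i)) \<noteq> 0"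
    unfolding bd_def by (metis (no_types, lifting) mult_zero_right sum.neutral)
  define G where "G = F(l \<mapsto> i)"
  have G: "G \<in> faces p n" "card (dom G) = Suc k"
    using l(2) assms unfolding G_def homog_def by blast+
  have F: "F = G(l := None)" using l(1) by (auto simp: G_def)
  have "l \<in> dom G" by (simp add: G_def)
  then show "F \<in> faces p n \<and> card (dom F) = k"
    using faces_del[OF G(1), of l] card_dom_del[OF _ G(2), of l] F by simp
qed

lemma homog_empty_chain: "homog p n 0 empty_chain"
  by (auto simp: homog_def empty_chain_def faces_def)

lemma diff_norm_op: "diff_op p (norm_op p z) F = 0"
proof (cases p)
  case 0
  then show ?thesis by (simp add: diff_op_def norm_op_def)
next
  case (Suc q)
  have "norm_op p z (shift p F) = (\<Sum>j<Suc q. z ((shift p ^^ Suc j) F))"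
    by (simp add: norm_op_def Suc funpow_swap1)
  also have "\<dots> = (\<Sum>j<q. z ((shift p ^^ Suc j) F)) + z ((shift p ^^ p) F)"
    by (simp add: Suc)
  also have "\<dots> = norm_op p z F"
    unfolding norm_op_def by (simp add: Suc sum.lessThan_Suc_shift del: sum.lessThan_Suc)
      (metis Suc shift_pow_p funpow.simps(2) comp_apply)
  finally show ?thesis by (simp add: diff_op_def)
qed

lemma norm_diff_op: "norm_op p (diff_op p z) F = 0"
proof -
  have "norm_op p (diff_op p z) F = (\<Sum>j<p. z ((shift p ^^ Suc j) F) - z ((shift p ^^ j) F))"
    by (simp add: norm_op_def diff_op_def)
  also have "\<dots> = z ((shift p ^^ p) F) - z ((shift p ^^ 0) F)"
    by (rule sum_lessThan_telescope)
  finally show ?thesis by simp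
qed

text \<open>On nonempty faces the rotation acts on this sign by \<open>rot p\<close>, so every orbit
  of such faces has exactly one member with leading sign \<open>0\<close>.\<close>

definition lead :: "(nat \<rightharpoonup> nat) \<Rightarrow> nat" where
  "lead F = the (F (LEAST l. l \<in> dom F))"

lemma lead_in:
  assumes "F \<noteq> Map.empty"
  shows "F (LEAST l. l \<in> dom F) = Some (lead F)"
proof -
  have "\<exists>l. l \<in> dom F" using assms by (auto simp: fun_eq_iff)
  then have "(LEAST l. l \<in> dom F) \<in> dom F" by (rule LeastI_ex)
  then show ?thesis by (auto simp: lead_def)
qed

lemma lead_less: "F \<in> faces p n \<Longrightarrow> F \<noteq> Map.empty \<Longrightarrow> lead F < p"
  using lead_in[of F] by (auto simp: faces_def ran_def)

lemma lead_shift: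
  assumes "F \<noteq> Map.empty"
  shows "lead (shift p F) = rot p (lead F)"
  unfolding lead_def[of "shift p F"] dom_shift using lead_in[OF assms] by (simp add: shift_def)

lemma lead_shift_pow:
  assumes "F \<in> faces p n" "F \<noteq> Map.empty"
  shows "lead ((shift p ^^ j) F) = (lead F + j) mod p"
proof -
  have "(shift p ^^ j) F \<noteq> Map.empty \<and> lead ((shift p ^^ j) F) = (rot p ^^ j) (lead F)"
    by (induction j) (use assms in \<open>auto simp: lead_shift\<close>)
  then show ?thesis using rot_pow lead_less[OF assms] by simp
qed

lemma homog_nonempty: "homog p n k z \<Longrightarrow> 0 < k \<Longrightarrow> z F \<noteq> 0 \<Longrightarrow> F \<noteq> Map.empty"
  by (force simp: homog_def)

lemma sum_rotate:
  fixes p r :: nat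
  assumes "r < p"
  shows "(\<Sum>j<p. h ((r + j) mod p)) = (\<Sum>j<p. h j :: int)"
proof -
  have "(\<Sum>j<p. h ((rot p ^^ r) j)) = (\<Sum>j<p. h j)"
    by (rule sum.reindex_bij_betw[OF bij_betw_funpow[OF bij_betw_rot]])
  then show ?thesis by (simp add: rot_pow add.commute)
qed

text \<open>Such a chain is constant on orbits, hence the norm of its restriction to the
  representatives with leading sign \<open>0\<close>. Positive degree keeps out the empty face, the
  only fixed one.\<close>

lemma ker_diff_op:
  assumes z: "homog p n k z" and "0 < k" and ker: "\<And>F. diff_op p z F = 0"
  shows "\<exists>y. homog p n k y \<and> z = norm_op p y"
proof (intro exI conjI)
  define y where "y F = (if lead F = 0 then z F else 0)" for F
  show y: "homog p n k y" using z by (auto simp: homog_def y_def)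
  have inv: "z ((shift p ^^ j) F) = z F" for j F
    by (induction j) (use ker in \<open>auto simp: diff_op_def\<close>)
  show "z = norm_op p y"
  proof
    fix F
    show "z F = norm_op p y F"
    proof (cases "z F = 0")
      case True
      then show ?thesis unfolding norm_op_def y_def inv by (auto intro: sum.neutral)
    next
      case False
      then have F: "F \<in> faces p n" "F \<noteq> Map.empty"
        using homog_face[OF z] homog_nonempty[OF z \<open>0 < k\<close>] by auto
      have "norm_op p y F = (\<Sum>j<p. if (lead F + j) mod p = 0 then z F else 0)"
        unfolding norm_op_def y_def inv lead_shift_pow[OF F] ..
      also have "\<dots> = (\<Sum>j<p. if j = 0 then z F else 0)"
        using sum_rotate[OF lead_less[OF F], of "\<lambda>j. if j = 0 then z F else 0"] by simp
      also have "\<dots> = z F" using lead_less[OF F] by simp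
      finally show ?thesis by simp
    qed
  qed
qed

lemma ker_norm_op:
  assumes z: "homog p n k z" and "0 < k" and ker: "\<And>F. norm_op p z F = 0"
  shows "\<exists>y. homog p n k y \<and> z = diff_op p y"
proof (intro exI conjI)
  \<comment> \<open>Partial sums of \<open>z\<close> along the orbit: \<open>p - lead F\<close>
    rotations lead from \<open>F\<close> to the representative with leading sign \<open>0\<close>,
    and the sum runs from there up to, but excluding, \<open>F\<close>.\<close>
  define y where "y F = (\<Sum>j<lead F. z ((shift p ^^ (p - lead F + j)) F))" for F
  show y: "homog p n k y"
    unfolding homog_def
  proof (intro allI impI)
    fix F assume "y F \<noteq> 0"
    then obtain j where "z ((shift p ^^ j) F) \<noteq> 0"
      unfolding y_def by (meson sum.neutral)
    then show "F \<in> faces p n \<and> card (dom F) = k"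
      using homog_shift_pow[OF z, of j] by (simp add: homog_def)
  qed
  show "z = diff_op p y"
  proof
    fix F
    show "z F = diff_op p y F"
    proof (cases "F \<in> faces p n \<and> F \<noteq> Map.empty")
      case False
      then have "F \<notin> faces p n \<or> F = Map.empty" by simp
      then have "y F = 0" "y (shift p F) = 0" "z F = 0"
        using homog_face[OF y] homog_face[OF z] homog_nonempty[OF y \<open>0 < k\<close>] 
          homog_nonempty[OF z \<open>0 < k\<close>] by (metis shift_faces shift_eq_empty)+
      then show ?thesis by (simp add: diff_op_def)
    next
      case True
      then have F: "F \<in> faces p n" "F \<noteq> Map.empty" by auto
      define r where "r = lead F"
      have r: "r < p" using lead_less[OF F] by (simp add: r_def)
      have ls: "lead (shift p F) = Suc r mod p"
        using lead_shift[OF F(2), of p] r by (simp add: r_def rot_def)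
      have sw: "(shift p ^^ j) (shift p F) = (shift p ^^ Suc j) F" for j
        by (simp only: funpow_Suc_right comp_apply)
      show ?thesis
      proof (cases "Suc r < p")
        case True
        have e: "Suc (p - Suc r + j) = p - r + j" for j using True by simp
        have "y (shift p F) = (\<Sum>j<Suc r. z ((shift p ^^ (p - r + j)) F))"
          unfolding y_def ls using True by (simp only: sw e mod_less)
        also have "\<dots> = y F + z ((shift p ^^ p) F)"
          using r by (simp add: y_def r_def)
        finally show ?thesis by (simp add: diff_op_def)
      next
        case False
        \<comment> \<open>At the wrap-around the partial sum restarts at \<open>0\<close>; this is
          consistent because the sum of \<open>z\<close> over the whole orbit vanishes.\<close>
        then have p: "p = Suc r" using r by simp
        have "y F = (\<Sum>j<r. z ((shift p ^^ Suc j) F))"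
          by (simp add: y_def r_def[symmetric] p)
        moreover have "norm_op p z F = z F + (\<Sum>j<r. z ((shift p ^^ Suc j) F))"
          unfolding norm_op_def by (simp add: p sum.lessThan_Suc_shift del: sum.lessThan_Suc)
        moreover have "y (shift p F) = 0" unfolding y_def ls using p by simp
        ultimately show ?thesis using ker[of F] by (simp add: diff_op_def)
      qed
    qed
  qed
qed

section \<open>Alternating operators and the descent to divisibility by \<open>p\<close>\<close>

text \<open>The operator occurring in the boundary of the chain with \<open>k + 1\<close> vertices.
  In degree \<open>0\<close> it is the identity, since the boundary of a single vertex is the empty
  face.\<close>

definition theta :: "nat \<Rightarrow> nat \<Rightarrow> ((nat \<rightharpoonup> nat) \<Rightarrow> int) \<Rightarrow> (nat \<rightharpoonup> nat) \<Rightarrow> int" where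
  "theta p k z = (if k = 0 then z else if odd k then diff_op p z else norm_op p z)"

lemma homog_theta: "homog p n k z \<Longrightarrow> homog p n k (theta p j z)"
  by (simp add: theta_def homog_diff_op homog_norm_op)

lemma bd_theta: "bd p n (theta p k z) = theta p k (bd p n z)"
  by (auto simp: theta_def bd_diff_op bd_norm_op)

lemma theta_theta: "k > 0 \<Longrightarrow> theta p (Suc k) (theta p k z) F = 0"
  by (simp add: theta_def diff_norm_op norm_diff_op)

lemma theta_sub: "theta p k (\<lambda>F. y F - z F) F = theta p k y F - theta p k z F"
  by (simp add: theta_def diff_op_def norm_op_def sum_subtractf)

lemma ker_theta:
  assumes "homog p n k z" "0 < k" "\<And>F. theta p (Suc j) z F = 0"
  shows "\<exists>y. homog p n k y \<and> z = theta p (Suc (Suc j)) y"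
  using ker_diff_op[OF assms(1,2)] ker_norm_op[OF assms(1,2)] assms(3)
  by (cases "odd j") (auto simp: theta_def)

lemma theta_Suc_Suc: "k > 0 \<Longrightarrow> theta p (Suc (Suc k)) = theta p k"
  by (auto simp: theta_def fun_eq_iff)

text \<open>Descending from \<open>X n = 0\<close>, exactness of the alternating operators writes
  every \<open>X k\<close> with \<open>k \<ge> 1\<close> as a boundary plus a
  \<open>theta\<close>-image. For \<open>k = 1\<close> that image is a norm, and comparing
  boundaries at the empty face, where the norm multiplies by \<open>p\<close>, gives
  \<open>p\<close> dividing \<open>1\<close>.\<close>

lemma no_vanishing_chain_sequence:
  assumes "p \<ge> 2" "n \<ge> 1"
    and homog: "\<And>k. k \<le> n \<Longrightarrow> homog p n k (X k)"
    and X0: "X 0 = empty_chain"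
    and bdX: "\<And>k. k < n \<Longrightarrow> bd p n (X (Suc k)) = theta p k (X k)"
    and Xn: "\<And>F. X n F = 0"
  shows False
proof -
  \<comment> \<open>The downward induction replaces \<open>1\<close> by \<open>k\<close>. In its
    step the previous \<open>w\<close> becomes the new \<open>y\<close>, and exactness supplies the
    new \<open>w\<close>.\<close>
  have "\<exists>y w. homog p n (Suc 1) y \<and> homog p n 1 w \<and> 
     X 1 = (\<lambda>F. bd p n y F + theta p (Suc 1) w F)"
    using \<open>n \<ge> 1\<close>
  proof (induction rule: inc_induct)
    case base
    show ?case
      using Xn homog_zero by (intro exI[of _ "\<lambda>F. 0"])
        (simp add: fun_eq_iff bd_def theta_def norm_op_def diff_op_def)
  next
    case (step k)
    then obtain y w where y: "homog p n (Suc (Suc k)) y" and w: "homog p n (Suc k) w"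
      and X: "X (Suc k) = (\<lambda>F. bd p n y F + theta p (Suc (Suc k)) w F)"
      by blast
    from \<open>1 \<le> k\<close> obtain j where k: "k = Suc j" by (metis Suc_le_D One_nat_def)
    have "theta p k (X k) F = theta p k (bd p n w) F" for F
    proof -
      have "theta p k (X k) F = bd p n (X (Suc k)) F" using bdX[OF \<open>k < n\<close>] by simp
      also have "\<dots> = bd p n (theta p (Suc (Suc k)) w) F"
        unfolding X by (simp add: bd_add)
      finally show ?thesis using \<open>1 \<le> k\<close> by (simp add: bd_theta theta_Suc_Suc)
    qed
    then have "theta p (Suc j) (\<lambda>F. X k F - bd p n w F) F = 0" for F
      by (simp add: theta_sub k)
    moreover have "homog p n k (\<lambda>F. X k F - bd p n w F)"
      using homog[of k] \<open>k < n\<close> homog_bd[OF w] by (intro homog_diff) auto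
    ultimately obtain v where v: "homog p n k v" "(\<lambda>F. X k F - bd p n w F) = theta p (Suc (Suc j)) v"
      using ker_theta[of p n k "\<lambda>F. X k F - bd p n w F" j] k by blast
    then have "X k = (\<lambda>F. bd p n w F + theta p (Suc k) v F)"
      by (simp add: fun_eq_iff k) (metis add.commute diff_add_cancel)
    with v w show ?case by blast
  qed
  then obtain y w where X1: "X 1 = (\<lambda>F. bd p n y F + norm_op p w F)"
    by (auto simp: theta_def)
  have "bd p n (X 1) Map.empty = int p * bd p n w Map.empty"
    unfolding X1 by (simp add: bd_add bd_norm_op) 
      (simp add: norm_op_def shift_pow fun_eq_iff o_def)
  moreover have "bd p n (X 1) = empty_chain" using bdX[of 0] X0 \<open>n \<ge> 1\<close> by (simp add: theta_def)
  ultimately have "1 = int p * bd p n w Map.empty" by (simp add: empty_chain_def)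
  then have "int p dvd 1" by (metis dvd_triv_left)
  then show False using \<open>p \<ge> 2\<close> by simp
qed

section \<open>Chains with the prescribed alternating boundaries\<close>

primrec fundamental_chain :: "nat \<Rightarrow> nat \<Rightarrow> (nat \<rightharpoonup> nat) \<Rightarrow> int" where
  "fundamental_chain p 0 = empty_chain"
| "fundamental_chain p (Suc k) = wedge k 0 (theta p k (fundamental_chain p k))"

lemma homog_fundamental_chain:
  assumes "p > 0"
  shows "homog p k k (fundamental_chain p k)"
proof (induction k)
  case 0
  show ?case by (simp add: homog_empty_chain)
next
  case (Suc k)
  show ?case unfolding homog_def
  proof (intro allI impI)
    fix F assume "fundamental_chain p (Suc k) F \<noteq> 0"
    then have F: "F k = Some 0" "theta p k (fundamental_chain p k) (F(k := None)) \<noteq> 0"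
      by (auto simp: wedge_def split: if_splits)
    define G where "G = F(k := None)"
    have "G \<in> faces p k" "card (dom G) = k"
      using F(2) homog_theta[OF Suc, of k] unfolding G_def homog_def by blast+
    moreover have "G \<in> faces p (Suc k)" using \<open>G \<in> faces p k\<close> by (force simp: faces_def)
    moreover have FG: "F = G(k \<mapsto> 0)" using F(1) by (auto simp: G_def)
    moreover have "k \<notin> dom G" by (simp add: G_def)
    ultimately show "F \<in> faces p (Suc k) \<and> card (dom F) = Suc k"
      using faces_upd[of G p "Suc k" k 0] assms finite_dom_faces by simp
  qed
qed

text \<open>The chain being coned is a cycle, because consecutive operators \<open>theta\<close>
  compose to zero, and it avoids the new position \<open>k\<close>. The cone formula therefore
  returns it as the boundary.\<close>

lemma bd_fundamental_chain:
  assumes "p > 0" "k < n"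
  shows "bd p n (fundamental_chain p (Suc k)) = theta p k (fundamental_chain p k)"
  using assms(2)
proof (induction k)
  case 0
  have "wedge 0 0 (\<lambda>F. 0) = (\<lambda>F. 0)" by (simp add: wedge_def fun_eq_iff)
  moreover have "bd p n (wedge 0 0 empty_chain) F = 
      empty_chain F - wedge 0 0 (bd p n empty_chain) F" for F
    using assms by (intro bd_wedge) (auto simp: empty_chain_def split: if_splits)
  moreover have "bd p n empty_chain = (\<lambda>F. 0)" by (simp add: fun_eq_iff)
  ultimately show ?case by (simp add: fun_eq_iff theta_def)
next
  case (Suc k)
  define z where "z = theta p (Suc k) (fundamental_chain p (Suc k))"
  have "homog p (Suc k) (Suc k) z"
    unfolding z_def by (intro homog_theta homog_fundamental_chain assms)
  then have supp: "F (Suc k) = None" if "z F \<noteq> 0" for F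
    using homog_face[of p "Suc k" "Suc k" z F] that by (force simp: faces_def)
  have "bd p n z F = 0" for F
  proof -
    have "bd p n z = theta p (Suc k) (theta p k (fundamental_chain p k))"
      using Suc by (simp add: z_def bd_theta)
    then show ?thesis
      \<comment> \<open>For \<open>k = 0\<close> the inner operator is the identity; there the outer
        one kills the empty chain, which is rotation invariant.\<close>
      using theta_theta[of k p "fundamental_chain p k" F]
      by (cases "k = 0") (auto simp: theta_def diff_op_def empty_chain_def)
  qed
  then have "bd p n (wedge (Suc k) 0 z) F = z F" for F
    using Suc.prems assms supp by (subst bd_wedge) (fastforce simp: wedge_def)+
  then show ?case by (auto simp: z_def)
qed

section \<open>A Tucker lemma for cyclic groups\<close>

text \<open>The image of the barycentric subdivision of \<open>Y\<close> under the labelling: the barycenter of \<open>Y\<close>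
  is coned off with the subdivided boundary.\<close>

primrec subdivision ::
  "((nat \<rightharpoonup> nat) \<Rightarrow> nat) \<Rightarrow> ((nat \<rightharpoonup> nat) \<Rightarrow> nat) \<Rightarrow> nat \<Rightarrow> (nat \<rightharpoonup> nat) \<Rightarrow> (nat \<rightharpoonup> nat) \<Rightarrow> int" where
  "subdivision lev sign 0 Y = empty_chain"
| "subdivision lev sign (Suc k) Y =
     wedge (lev Y) (sign Y) (\<lambda>F. \<Sum>m\<in>dom Y. sg Y m * subdivision lev sign k (Y(m := None)) F)"

text \<open>The linear extension of \<open>subdivision\<close> to chains with \<open>k\<close>
  vertices, so the chain map induced by the labelling.\<close>

definition push ::
  "nat \<Rightarrow> nat \<Rightarrow> ((nat \<rightharpoonup> nat) \<Rightarrow> nat) \<Rightarrow> ((nat \<rightharpoonup> nat) \<Rightarrow> nat) \<Rightarrow> nat \<Rightarrow> ((nat \<rightharpoonup> nat) \<Rightarrow> int) \<Rightarrow> (nat \<rightharpoonup> nat) \<Rightarrow> int" where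
  "push p n lev sign k z F =
     (\<Sum>Y\<in>{Y\<in>faces p n. card (dom Y) = k}. z Y * subdivision lev sign k Y F)"

text \<open>The second clause says that along an increasing sequence of vectors no level receives
  two signs. So \<open>lev\<close> and \<open>sign\<close> together give an equivariant simplicial
  map from the barycentric subdivision to the join of \<open>N\<close> copies.\<close>

definition equivariant_labelling ::
  "nat \<Rightarrow> nat \<Rightarrow> nat \<Rightarrow> ((nat \<rightharpoonup> nat) \<Rightarrow> nat) \<Rightarrow> ((nat \<rightharpoonup> nat) \<Rightarrow> nat) \<Rightarrow> bool" where
  "equivariant_labelling p n N lev sign \<longleftrightarrow>
     (\<forall>Y\<in>faces p n. Y \<noteq> Map.empty \<longrightarrow>
        lev Y < N \<and> sign Y < p \<and> lev (shift p Y) = lev Y \<and> sign (shift p Y) = rot p (sign Y)) \<and>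
     (\<forall>X\<in>faces p n. \<forall>Y\<in>faces p n. X \<noteq> Map.empty \<longrightarrow> X \<subseteq>\<^sub>m Y \<longrightarrow> lev X = lev Y \<longrightarrow> sign X = sign Y)"

text \<open>Each coning step adds the label of the current vector, and the recursion only passes to
  subvectors. This control of the vertices provides the compatibility required by the cone
  formula.\<close>

lemma subdivision_carrier:
  assumes "subdivision lev sign k Y F \<noteq> 0" "Y \<in> faces p n" "card (dom Y) = k"
  shows "finite (dom F) \<and> card (dom F) = k \<and>
    (\<forall>l i. F l = Some i \<longrightarrow> (\<exists>X. X \<subseteq>\<^sub>m Y \<and> X \<noteq> Map.empty \<and> lev X = l \<and> sign X = i))"
  using assms
proof (induction k arbitrary: Y F)
  case 0
  then show ?case by (simp add: empty_chain_def split: if_splits)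
next
  case (Suc k)
  define G where "G = F(lev Y := None)"
  have F: "F (lev Y) = Some (sign Y)" and
    "(\<Sum>m\<in>dom Y. sg Y m * subdivision lev sign k (Y(m := None)) G) \<noteq> 0"
    using Suc.prems(1) by (auto simp: wedge_def G_def split: if_splits)
  then obtain m where m: "m \<in> dom Y" "subdivision lev sign k (Y(m := None)) G \<noteq> 0"
    by (metis (no_types, lifting) mult_zero_right sum.neutral)
  have IH: "finite (dom G) \<and> card (dom G) = k \<and> (\<forall>l i. G l = Some i \<longrightarrow>
    (\<exists>X. X \<subseteq>\<^sub>m Y(m := None) \<and> X \<noteq> Map.empty \<and> lev X = l \<and> sign X = i))"
    using Suc.IH[OF m(2) faces_del[OF Suc.prems(2)] card_dom_del[OF m(1) Suc.prems(3)]] .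
  have FG: "F = G(lev Y \<mapsto> sign Y)" using F by (auto simp: G_def)
  have "lev Y \<notin> dom G" by (simp add: G_def)
  then have 1: "finite (dom F)" "card (dom F) = Suc k" using IH FG by simp_all
  have "\<exists>X. X \<subseteq>\<^sub>m Y \<and> X \<noteq> Map.empty \<and> lev X = l \<and> sign X = i" if l: "F l = Some i" for l i
  proof (cases "l = lev Y")
    case True
    have "Y \<noteq> Map.empty" using m(1) by auto
    then show ?thesis using True F l by (intro exI[of _ Y]) auto
  next
    case False
    then have "G l = Some i" using l by (simp add: G_def)
    then obtain X where X: "X \<subseteq>\<^sub>m Y(m := None)" "X \<noteq> Map.empty \<and> lev X = l \<and> sign X = i"
      using IH by blast
    have "X \<subseteq>\<^sub>m Y" using X(1) unfolding map_le_def
      by (metis domIff fun_upd_apply)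
    then show ?thesis using X(2) by blast
  qed
  then show ?case using 1 by blast
qed

lemma faces_map_le: "X \<subseteq>\<^sub>m Y \<Longrightarrow> Y \<in> faces p n \<Longrightarrow> X \<in> faces p n"
  by (force simp: faces_def ran_def map_le_def dom_def)

context
  fixes p n N :: nat and lev sign :: "(nat \<rightharpoonup> nat) \<Rightarrow> nat"
  assumes lab: "equivariant_labelling p n N lev sign" and N: "N \<le> n"
begin

lemma subdivision_faces:
  assumes "subdivision lev sign k Y F \<noteq> 0" "Y \<in> faces p n" "card (dom Y) = k"
  shows "F \<in> faces p N" "card (dom F) = k"
proof -
  have F: "F l = Some i \<Longrightarrow> l < N \<and> i < p" for l i
    using subdivision_carrier[OF assms] faces_map_le[OF _ assms(2)] lab
    unfolding equivariant_labelling_def by metis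
  then show "F \<in> faces p N" by (auto simp: faces_def ran_def)
  show "card (dom F) = k" using subdivision_carrier[OF assms] by blast
qed

text \<open>By the cone formula it suffices that the coned chain is a cycle. Inductively its
  boundary removes two positions from \<open>Y\<close>, and the two orders of removal
  cancel.\<close>

lemma bd_subdivision:
  assumes "Y \<in> faces p n" "card (dom Y) = Suc k"
  shows "bd p n (subdivision lev sign (Suc k) Y) F =
    (\<Sum>m\<in>dom Y. sg Y m * subdivision lev sign k (Y(m := None)) F)"
  using assms
proof (induction k arbitrary: Y F)
  case (0 Y F)
  define w where "w F = (\<Sum>m\<in>dom Y. sg Y m * subdivision lev sign 0 (Y(m := None)) F)" for F
  have Y: "Y \<noteq> Map.empty" using 0 by auto
  have "bd p n w F = 0" for F
    unfolding w_def[abs_def] by (simp add: bd_sum)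
  moreover have "lev Y < n" "sign Y < p"
    using lab 0 N Y unfolding equivariant_labelling_def by fastforce+
  moreover have "F (lev Y) = None" if "w F \<noteq> 0" for F
    using that by (cases "F = Map.empty") (simp_all add: w_def empty_chain_def)
  ultimately have "bd p n (wedge (lev Y) (sign Y) w) F = w F"
    by (subst bd_wedge) (fastforce simp: wedge_def)+
  then show ?case by (simp add: w_def[abs_def])
next
  case (Suc k)
  define w where "w F = (\<Sum>m\<in>dom Y. sg Y m * subdivision lev sign (Suc k) (Y(m := None)) F)" for F
  have Y: "Y \<noteq> Map.empty" using Suc.prems by auto
  have bdw: "bd p n w F = 0" for F
  proof -
    define g where "g m m' = (if m = m' then 0 else
      sg Y m * sg (Y(m := None)) m' * subdivision lev sign k (Y(m := None, m' := None)) F)" for m m'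
    have "bd p n w F = 
        (\<Sum>m\<in>dom Y. sg Y m * bd p n (subdivision lev sign (Suc k) (Y(m := None))) F)"
      unfolding w_def[abs_def] by (rule bd_sum)
    also have "\<dots> = (\<Sum>m\<in>dom Y. \<Sum>m'\<in>dom Y. g m m')"
    proof (rule sum.cong[OF refl])
      fix m assume m: "m \<in> dom Y"
      have "sg Y m * bd p n (subdivision lev sign (Suc k) (Y(m := None))) F =
        sg Y m * (\<Sum>m'\<in>dom (Y(m := None)). sg (Y(m := None)) m' * 
          subdivision lev sign k (Y(m := None, m' := None)) F)"
        by (simp only: Suc.IH[OF faces_del[OF Suc.prems(1)] card_dom_del[OF m Suc.prems(2)]])
      also have "\<dots> = (\<Sum>m'\<in>dom Y - {m}. g m m')"
        unfolding sum_distrib_left by (rule sum.cong) (auto simp: g_def)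
      also have "\<dots> = (\<Sum>m'\<in>dom Y. g m m')"
        using finite_dom_faces[OF Suc.prems(1)] by (intro sum.mono_neutral_left) (auto simp: g_def)
      finally show "sg Y m * bd p n (subdivision lev sign (Suc k) (Y(m := None))) F = \<dots>" .
    qed
    also have "\<dots> = 0"
    proof (rule sum_antisym)
      fix a b assume ab: "a \<in> dom Y" "b \<in> dom Y"
      show "g a b = - g b a"
        using ab sg_del[OF ab(1), of b] sg_del[OF ab(2), of a]
        by (cases "a < b") (auto simp: g_def fun_upd_twist[of a b])
    qed
    finally show ?thesis .
  qed
  have "lev Y < n" "sign Y < p"
    using lab Suc.prems N Y unfolding equivariant_labelling_def by fastforce+
  \<comment> \<open>A vertex of \<open>w\<close> on the level of \<open>Y\<close> is the label of a
    subvector of \<open>Y\<close>; equal levels of comparable vectors force equal signs.\<close>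
  moreover have "j = sign Y" if wF: "w F \<noteq> 0" and Fj: "F (lev Y) = Some j" for F j
  proof -
    have "\<exists>m\<in>dom Y. subdivision lev sign (Suc k) (Y(m := None)) F \<noteq> 0"
    proof (rule ccontr)
      assume "\<not> ?thesis"
      then have "w F = 0" by (simp add: w_def del: subdivision.simps)
      then show False using wF by simp
    qed
    then obtain m where m: "m \<in> dom Y" "subdivision lev sign (Suc k) (Y(m := None)) F \<noteq> 0"
      by blast
    obtain X where X: "X \<subseteq>\<^sub>m Y(m := None)" "X \<noteq> Map.empty" "lev X = lev Y" "sign X = j"
      using subdivision_carrier[OF m(2) faces_del[OF Suc.prems(1)] card_dom_del[OF m(1) Suc.prems(2)]]
        Fj by blast
    have "X \<subseteq>\<^sub>m Y" using X(1) unfolding map_le_def by (metis domIff fun_upd_apply)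
    then show ?thesis
      using lab X Suc.prems(1) faces_map_le unfolding equivariant_labelling_def by blast
  qed
  ultimately have "bd p n (wedge (lev Y) (sign Y) w) F = w F"
    using bd_wedge[of "lev Y" n "sign Y" p w F] bdw by (simp add: wedge_def)
  then show ?case by (simp only: w_def[abs_def] subdivision.simps(2)[of lev sign "Suc k" Y])
qed

lemma subdivision_shift:
  assumes "Y \<in> faces p n" "card (dom Y) = k"
  shows "subdivision lev sign k (shift p Y) (shift p F) = subdivision lev sign k Y F"
  using assms
proof (induction k arbitrary: Y F)
  case 0
  then show ?case by (simp add: empty_chain_def)
next
  case (Suc k)
  have Y: "Y \<noteq> Map.empty" using Suc.prems by auto
  have l: "lev (shift p Y) = lev Y" "sign (shift p Y) = rot p (sign Y)"
    using lab Suc.prems(1) Y unfolding equivariant_labelling_def by blast+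
  have "shift p F (lev Y) = Some (rot p (sign Y)) \<longleftrightarrow> F (lev Y) = Some (sign Y)"
    using inj_rot[of p] by (auto simp: shift_def inj_def)
  moreover have "(\<Sum>m\<in>dom Y. sg Y m * subdivision lev sign k ((shift p Y)(m := None)) ((shift p F)(lev Y := None))) =
    (\<Sum>m\<in>dom Y. sg Y m * subdivision lev sign k (Y(m := None)) (F(lev Y := None)))"
    unfolding shift_del[symmetric]
    by (intro sum.cong refl) (simp only: Suc.IH faces_del[OF Suc.prems(1)] card_dom_del[OF _ Suc.prems(2)])
  ultimately show ?case by (simp add: wedge_def l)
qed

lemma push_shift: "push p n lev sign k z (shift p F) = push p n lev sign k (\<lambda>F. z (shift p F)) F"
proof -
  let ?A = "{Y\<in>faces p n. card (dom Y) = k}"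
  have inj: "inj_on (shift p) ?A" using inj_shift inj_on_subset by blast
  have "bij_betw (shift p) ?A ?A"
    unfolding bij_betw_def using inj by (intro conjI endo_inj_surj) auto
  then have "push p n lev sign k z (shift p F) = 
      (\<Sum>Y\<in>?A. z (shift p Y) * subdivision lev sign k (shift p Y) (shift p F))"
    unfolding push_def by (rule sum.reindex_bij_betw[symmetric])
  also have "\<dots> = push p n lev sign k (\<lambda>F. z (shift p F)) F"
    unfolding push_def by (intro sum.cong refl) (simp add: subdivision_shift)
  finally show ?thesis .
qed

lemma push_shift_pow:
  "push p n lev sign k z ((shift p ^^ j) F) = push p n lev sign k (\<lambda>F. z ((shift p ^^ j) F)) F"
proof (induction j arbitrary: F)
  case (Suc j)
  have "push p n lev sign k z ((shift p ^^ Suc j) F) = push p n lev sign k z ((shift p ^^ j) (shift p F))"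
    by (simp only: funpow_Suc_right comp_apply)
  also have "\<dots> = push p n lev sign k (\<lambda>F. z ((shift p ^^ j) (shift p F))) F"
    by (simp add: Suc push_shift)
  finally show ?case by (simp only: funpow_Suc_right comp_apply)
qed simp

lemma push_theta: "push p n lev sign k (theta p j z) F = theta p j (push p n lev sign k z) F"
proof -
  have "push p n lev sign k (diff_op p z) F = diff_op p (push p n lev sign k z) F"
    unfolding diff_op_def push_shift
    by (simp add: push_def diff_op_def sum_subtractf left_diff_distrib)
  moreover have "push p n lev sign k (norm_op p z) F = norm_op p (push p n lev sign k z) F"
    unfolding norm_op_def push_shift_pow
    by (simp add: push_def sum_distrib_right) (rule sum.swap)
  ultimately show ?thesis by (simp add: theta_def)
qed

lemma homog_push: "homog p N k (push p n lev sign k z)"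
  unfolding homog_def
proof (intro allI impI)
  fix F assume "push p n lev sign k z F \<noteq> 0"
  then obtain Y where "Y \<in> faces p n" "card (dom Y) = k" "subdivision lev sign k Y F \<noteq> 0"
    unfolding push_def by (metis (mono_tags, lifting) mem_Collect_eq mult_zero_right sum.neutral)
  then show "F \<in> faces p N \<and> card (dom F) = k" using subdivision_faces by blast
qed

text \<open>Termwise boundaries give a sum over pairs of a face and one of its positions. Regrouping
  by the face left after deletion, with the deleted position and its sign as extra data, gives the
  boundary of \<open>z\<close>.\<close>

lemma bd_push: "bd p n (push p n lev sign (Suc k) z) F = push p n lev sign k (bd p n z) F"
proof -
  let ?A = "\<lambda>k. {Y\<in>faces p n. card (dom Y) = k}"
  let ?S = "subdivision lev sign"
  have fd: "finite (dom Y)" if "Y \<in> ?A k" for Y k using that finite_dom_faces by auto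
  have "bd p n (push p n lev sign (Suc k) z) F = (\<Sum>Y\<in>?A (Suc k). z Y * bd p n (?S (Suc k) Y) F)"
    unfolding push_def[abs_def] by (rule bd_sum)
  also have "\<dots> = (\<Sum>Y\<in>?A (Suc k). \<Sum>m\<in>dom Y. z Y * (sg Y m * ?S k (Y(m := None)) F))"
    by (intro sum.cong refl) (simp add: bd_subdivision sum_distrib_left del: subdivision.simps)
  also have "\<dots> = (\<Sum>(Y, m)\<in>Sigma (?A (Suc k)) dom. z Y * (sg Y m * ?S k (Y(m := None)) F))"
    by (rule sum.Sigma) (use fd in auto)
  also have "\<dots> = (\<Sum>(Y, l, i)\<in>Sigma (?A k) (\<lambda>Y. ({..<n} - dom Y) \<times> {..<p}).
       sg Y l * z (Y(l \<mapsto> i)) * ?S k Y F)"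
  proof (rule sum.reindex_bij_witness[where
        i = "\<lambda>(Y, l, i). (Y(l \<mapsto> i), l)" and j = "\<lambda>(Y, m). (Y(m := None), m, the (Y m))"])
    fix a assume "a \<in> Sigma (?A (Suc k)) dom"
    then obtain Y m where a: "a = (Y, m)" "Y \<in> faces p n" "card (dom Y) = Suc k" "m \<in> dom Y"
      by auto
    then have m: "m < n" "the (Y m) < p" by (auto simp: faces_def ran_def)
    have Y: "Y(m \<mapsto> the (Y m)) = Y" using a by (auto simp: fun_upd_idem)
    show "(case case a of (Y, m) \<Rightarrow> (Y(m := None), m, the (Y m)) of 
      (Y, l, i) \<Rightarrow> (Y(l \<mapsto> i), l)) = a"
      using Y by (simp add: a)
    show "(case a of (Y, m) \<Rightarrow> (Y(m := None), m, the (Y m)))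
      \<in> Sigma (?A k) (\<lambda>Y. ({..<n} - dom Y) \<times> {..<p})"
      using a m faces_del card_dom_del[OF a(4,3)] by simp
    show "(case case a of (Y, m) \<Rightarrow> (Y(m := None), m, the (Y m)) of
      (Y, l, i) \<Rightarrow> sg Y l * z (Y(l \<mapsto> i)) * ?S k Y F) =
      (case a of (Y, m) \<Rightarrow> z Y * (sg Y m * ?S k (Y(m := None)) F))"
      using Y by (simp add: a)
  next
    fix b assume "b \<in> Sigma (?A k) (\<lambda>Y. ({..<n} - dom Y) \<times> {..<p})"
    then obtain Y l i where b: "b = (Y, l, i)" "Y \<in> faces p n" "card (dom Y) = k" 
        "l < n" "l \<notin> dom Y" "i < p"
      by auto
    show "(case case b of (Y, l, i) \<Rightarrow> (Y(l \<mapsto> i), l) of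
      (Y, m) \<Rightarrow> (Y(m := None), m, the (Y m))) = b"
      using b by (simp add: fun_upd_idem domIff)
    show "(case b of (Y, l, i) \<Rightarrow> (Y(l \<mapsto> i), l)) \<in> Sigma (?A (Suc k)) dom"
      using b faces_upd finite_dom_faces[OF b(2)] by simp
  qed
  also have "\<dots> = (\<Sum>Y\<in>?A k. \<Sum>(l, i)\<in>({..<n} - dom Y) \<times> {..<p}. sg Y l * z (Y(l \<mapsto> i)) * ?S k Y F)"
    by (subst sum.Sigma) auto
  also have "\<dots> = push p n lev sign k (bd p n z) F"
    unfolding push_def bd_def sum_distrib_right
    by (intro sum.cong refl) (simp add: sum.cartesian_product)
  finally show ?thesis .
qed

lemma push_empty_chain: "push p n lev sign 0 empty_chain F = empty_chain F"
proof -
  have "{Y\<in>faces p n. card (dom Y) = 0} = {Map.empty}"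
    using finite_dom_faces by (auto simp: faces_def)
  then show ?thesis by (simp add: push_def) (simp add: empty_chain_def)
qed

end

text \<open>If \<open>N < n\<close>, the images of the fundamental chains keep the alternating
  boundaries, yet the image in degree \<open>n\<close> vanishes: a face on \<open>N\<close> levels
  cannot have \<open>n\<close> vertices.\<close>

lemma Zp_Tucker:
  assumes p: "p \<ge> 2" and lab: "equivariant_labelling p n N lev sign"
  shows "n \<le> N"
proof (rule ccontr)
  assume "\<not> n \<le> N"
  then have N: "N \<le> n" "N < n" by auto
  define X where "X k = push p n lev sign k (fundamental_chain p k)" for k
  have hN: "homog p N k (X k)" for k
    unfolding X_def by (rule homog_push[OF lab N(1)])
  show False
  proof (rule no_vanishing_chain_sequence[of p n X])
    show "p \<ge> 2" by (rule p)
    show "n \<ge> 1" using N by simp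
    show "homog p n k (X k)" for k by (rule homog_mono[OF hN N(1)])
    show "X 0 = empty_chain"
      by (simp add: X_def fun_eq_iff push_empty_chain[OF lab N(1)])
    show "bd p n (X (Suc k)) = theta p k (X k)" if "k < n" for k
    proof
      fix F
      have "bd p n (X (Suc k)) F = push p n lev sign k (bd p n (fundamental_chain p (Suc k))) F"
        unfolding X_def by (rule bd_push[OF lab N(1)])
      also have "\<dots> = push p n lev sign k (theta p k (fundamental_chain p k)) F"
        using bd_fundamental_chain[of p k n] p that by simp
      also have "\<dots> = theta p k (X k) F"
        unfolding X_def by (rule push_theta[OF lab N(1)])
      finally show "bd p n (X (Suc k)) F = theta p k (X k) F" .
    qed
    show "X n F = 0" for F
    proof (rule ccontr)
      assume "X n F \<noteq> 0"
      then have "dom F \<subseteq> {..<N}" "card (dom F) = n"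
        using homog_face[OF hN] homog_card[OF hN] by (auto simp: faces_def)
      then show False using N card_mono[of "{..<N}" "dom F"] by simp
    qed
  qed
qed

section \<open>Equivariant choice of a sign\<close>

text \<open>Since \<open>d\<close> is invertible modulo the prime \<open>p\<close>, repeated steps
  of length \<open>d\<close> from \<open>0\<close> reach every \<open>i\<close>.\<close>

lemma rotation_invariant_constant:
  assumes "prime p" and d: "0 < d" "d < p" and inv: "u \<circ> (rot p ^^ d) = u" and "i < p"
  shows "u i = u 0"
proof -
  have step: "u ((i + d) mod p) = u i" if "i < p" for i
    using inv rot_pow[OF that, of d] by (metis comp_apply)
  have mult: "u ((m * d) mod p) = u 0" for m
  proof (induction m)
    case (Suc m)
    have "((m * d) mod p + d) mod p = (Suc m * d) mod p"
      by (simp add: mod_simps add.commute)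
    then show ?case using step[of "(m * d) mod p"] Suc d by simp
  qed simp
  have "coprime d p"
    using \<open>prime p\<close> d by (metis coprime_commute nat_dvd_not_less prime_imp_coprime)
  then obtain x where "[d * x = Suc 0] (mod p)" using cong_solve_coprime_nat by blast
  then have "[i * (d * x) = i * Suc 0] (mod p)" by (rule cong_scalar_left)
  then have "(i * x * d) mod p = i" using \<open>i < p\<close> by (simp add: cong_def mult_ac)
  then show ?thesis using mult[of "i * x"] by simp
qed

text \<open>A nonconstant \<open>u\<close> has \<open>p\<close> distinct rotations, so the number of
  rotations taking it to a representative chosen for its orbit is well defined below
  \<open>p\<close> and changes by one when \<open>u\<close> is rotated.\<close>

lemma equivariant_choice:
  fixes p :: nat
  assumes "prime p"
  obtains f :: "(nat \<Rightarrow> 'b) \<Rightarrow> nat"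
  where "\<And>u v. (\<And>i. v (rot p i) = u i) \<Longrightarrow> \<not> (\<exists>c. \<forall>i<p. u i = c) \<Longrightarrow> f u < p \<and> f v = rot p (f u)"
proof -
  have p: "p > 0" using assms prime_gt_0_nat by blast
  define orb where "orb u = range (\<lambda>j. u \<circ> (rot p ^^ j))" for u :: "nat \<Rightarrow> 'b"
  \<comment> \<open>The choice depends on the orbit as a set only, so \<open>u\<close> and its
    rotation \<open>v\<close> receive the same representative.\<close>
  define rep where "rep u = (SOME r. r \<in> orb u)" for u
  define f where "f u = (SOME j. j < p \<and> u \<circ> (rot p ^^ j) = rep u)" for u
  have red: "u \<circ> (rot p ^^ j) = u \<circ> (rot p ^^ (j mod p))" for u :: "nat \<Rightarrow> 'b" and j
  proof -
    have "(rot p ^^ j) x = (rot p ^^ (j mod p)) x" for x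
      by (cases "x < p") (simp_all add: rot_pow rot_pow_ge mod_simps)
    then show ?thesis by (simp add: fun_eq_iff)
  qed
  have f: "f u < p" "u \<circ> (rot p ^^ f u) = rep u" for u
  proof -
    have "rep u \<in> orb u" by (simp add: rep_def some_in_eq) (simp add: orb_def)
    then obtain j where "u \<circ> (rot p ^^ j) = rep u" by (auto simp: orb_def)
    then have "\<exists>j. j < p \<and> u \<circ> (rot p ^^ j) = rep u" using red[of u j] p by (metis mod_less_divisor)
    from someI_ex[OF this] show "f u < p" "u \<circ> (rot p ^^ f u) = rep u" unfolding f_def by auto
  qed
  have uniq_less: "\<exists>c. \<forall>i<p. u i = c" if "u \<circ> (rot p ^^ a) = u \<circ> (rot p ^^ b)" "a < b" "b < p" 
    for u :: "nat \<Rightarrow> 'b" and a b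
  proof -
    have "u = u \<circ> (rot p ^^ (a + (p - a)))"
      using that red[of u p] by simp
    also have "\<dots> = u \<circ> (rot p ^^ a) \<circ> (rot p ^^ (p - a))"
      by (simp only: funpow_add comp_assoc)
    also have "\<dots> = u \<circ> (rot p ^^ (b + (p - a)))"
      unfolding that(1) by (simp only: funpow_add comp_assoc)
    also have "\<dots> = u \<circ> (rot p ^^ (b - a))"
    proof -
      have "b + (p - a) = (b - a) + p" using that by simp
      then show ?thesis by (metis red mod_add_self2)
    qed
    finally have inv: "u \<circ> (rot p ^^ (b - a)) = u" by (rule sym)
    have "u i = u 0" if "i < p" for i
      by (rule rotation_invariant_constant[OF assms _ _ inv that])
        (use \<open>a < b\<close> \<open>b < p\<close> in simp_all)
    then show ?thesis by blast
  qed
  have uniq: "a = b" if "u \<circ> (rot p ^^ a) = u \<circ> (rot p ^^ b)" "a < p" "b < p" 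
    "\<not> (\<exists>c. \<forall>i<p. u i = c)" for u :: "nat \<Rightarrow> 'b" and a b
    using uniq_less[of u a b] uniq_less[of u b a] that by (metis linorder_neqE_nat)
  show ?thesis
  proof (rule that)
    fix u v :: "nat \<Rightarrow> 'b"
    assume uv: "\<And>i. v (rot p i) = u i" and nc: "\<not> (\<exists>c. \<forall>i<p. u i = c)"
    have vu: "v \<circ> (rot p ^^ Suc j) = u \<circ> (rot p ^^ j)" for j
      using uv by (simp add: fun_eq_iff)
    \<comment> \<open>One rotation backwards equals \<open>p - 1\<close> rotations forwards; this
      gives the converse inclusion of orbits.\<close>
    have uv': "u \<circ> (rot p ^^ (j + p - 1)) = v \<circ> (rot p ^^ j)" for j
    proof -
      have "Suc (j + p - 1) = j + p" using p by simp
      then show ?thesis using vu[of "j + p - 1"] red[of v "j + p"] red[of v j] by (metis mod_add_self2)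
    qed
    have "orb u \<subseteq> orb v" unfolding orb_def vu[symmetric] by blast
    moreover have "orb v \<subseteq> orb u" unfolding orb_def uv'[symmetric] by blast
    ultimately have "rep u = rep v" by (simp add: rep_def)
    have "v \<circ> (rot p ^^ f v) = v \<circ> (rot p ^^ Suc (f u))"
      by (simp only: f(2) vu[of "f u"] \<open>rep u = rep v\<close>)
    then have "v \<circ> (rot p ^^ f v) = v \<circ> (rot p ^^ (Suc (f u) mod p))"
      using red[of v "Suc (f u)"] by simp
    moreover have "\<not> (\<exists>c. \<forall>i<p. v i = c)"
      using nc uv by (metis rot_less)
    ultimately have "f v = Suc (f u) mod p"
      using uniq[of v "f v" "Suc (f u) mod p"] f(1) p by simp
    then show "f u < p \<and> f v = rot p (f u)" using f(1) by (simp add: rot_def)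
  qed
qed

section \<open>Labelling signed vectors\<close>

definition stab_num :: "nat \<Rightarrow> nat set \<Rightarrow> nat" where
  "stab_num s A = Max (card ` {S. S \<subseteq> A \<and> almost_stable s S})"

lemma stab_num_ge:
  assumes "finite A" "S \<subseteq> A" "almost_stable s S"
  shows "card S \<le> stab_num s A"
  unfolding stab_num_def by (rule Max_ge) (use assms in auto)

lemma stab_num_witness:
  assumes "finite A"
  obtains S where "S \<subseteq> A" "almost_stable s S" "card S = stab_num s A"
proof -
  have "{} \<in> {S. S \<subseteq> A \<and> almost_stable s S}" by (simp add: almost_stable_def)
  then have "stab_num s A \<in> card ` {S. S \<subseteq> A \<and> almost_stable s S}"
    unfolding stab_num_def using assms by (intro Max_in) auto
  then show ?thesis using that by auto
qed

lemma almost_stable_subset: "almost_stable s S \<Longrightarrow> T \<subseteq> S \<Longrightarrow> almost_stable s T"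
  by (auto simp: almost_stable_def)

lemma stab_num_mono:
  assumes "finite B" "A \<subseteq> B"
  shows "stab_num s A \<le> stab_num s B"
proof -
  have "finite A" using assms finite_subset by blast
  then obtain S where "S \<subseteq> A" "almost_stable s S" "card S = stab_num s A"
    by (rule stab_num_witness)
  then show ?thesis using stab_num_ge[of B S s] assms by simp
qed

lemma stab_num_empty [simp]: "stab_num s {} = 0"
  by (rule stab_num_witness[of "{}" s]) auto

lemma stab_num_pos: "finite A \<Longrightarrow> a \<in> A \<Longrightarrow> stab_num s A \<ge> 1"
  using stab_num_ge[of A "{a}" s] by (simp add: almost_stable_def)

lemma stab_num_insert:
  assumes "finite A" "a \<in> A" "B \<subseteq> A" "\<And>b. b \<in> B \<Longrightarrow> a + s \<le> b" "s > 0"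
  shows "stab_num s B < stab_num s A"
proof -
  have fB: "finite B" using assms finite_subset by blast
  then obtain S where S: "S \<subseteq> B" "almost_stable s S" "card S = stab_num s B"
    by (rule stab_num_witness)
  have "almost_stable s (insert a S)"
    unfolding almost_stable_def
  proof (intro ballI impI)
    fix i j assume "i \<in> insert a S" "j \<in> insert a S" "i \<noteq> j"
    then consider "i \<in> S" "j \<in> S" | "i = a" "a + s \<le> j" | "j = a" "a + s \<le> i"
      using assms(4) S(1) by blast
    then show "\<bar>int i - int j\<bar> \<ge> int s"
      using S(2) \<open>i \<noteq> j\<close> by cases (auto simp: almost_stable_def)
  qed
  then have "card (insert a S) \<le> stab_num s A"
    using assms S(1) by (intro stab_num_ge) auto
  moreover have "a \<notin> S" using S(1) assms(4)[of a] assms(5) by auto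
  moreover have "finite S" using S(1) fB finite_subset by blast
  ultimately show ?thesis using S(3) by simp
qed

text \<open>Positions start at \<open>0\<close>, whereas the ground set of the Kneser hypergraph is \<open>{1..n}\<close>.\<close>

definition sign_class :: "(nat \<rightharpoonup> nat) \<Rightarrow> nat \<Rightarrow> nat set" where
  "sign_class Y i = Suc ` {l. Y l = Some i}"

lemma sign_class_mono:
  assumes "X \<subseteq>\<^sub>m Y"
  shows "sign_class X i \<subseteq> sign_class Y i"
proof -
  have "Y l = Some i" if "X l = Some i" for l
    using assms that unfolding map_le_def by (metis domI)
  then show ?thesis by (auto simp: sign_class_def)
qed

lemma faces_SomeD: "Y \<in> faces p n \<Longrightarrow> Y l = Some i \<Longrightarrow> l < n \<and> i < p"
  by (auto simp: faces_def ran_def)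

lemma sign_class_faces: "Y \<in> faces p n \<Longrightarrow> sign_class Y i \<subseteq> {1..n}"
  by (auto simp: sign_class_def Suc_le_eq dest: faces_SomeD)

lemma finite_sign_class: "Y \<in> faces p n \<Longrightarrow> finite (sign_class Y i)"
  by (rule finite_subset[OF sign_class_faces]) simp_all

lemma sign_class_ge: "Y \<in> faces p n \<Longrightarrow> i \<ge> p \<Longrightarrow> sign_class Y i = {}"
  by (auto simp: sign_class_def dest: faces_SomeD)

lemma sign_class_disjoint: "i \<noteq> j \<Longrightarrow> sign_class Y i \<inter> sign_class Y j = {}"
  by (auto simp: sign_class_def)

lemma sign_class_shift: "sign_class (shift p Y) (rot p i) = sign_class Y i"
  using inj_rot[of p] by (auto simp: sign_class_def shift_def inj_def)

lemma all_rot_iff: "(\<forall>i<p. P (rot p i)) \<longleftrightarrow> (\<forall>i<p. P i)"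
proof -
  have "(\<forall>i\<in>{..<p}. P (rot p i)) \<longleftrightarrow> (\<forall>i\<in>rot p ` {..<p}. P i)" by simp
  also have "rot p ` {..<p} = {..<p}" using bij_betw_rot[of p] by (simp add: bij_betw_def)
  finally show ?thesis by (simp add: Ball_def)
qed

lemma sum_rot: "(\<Sum>i<p. h (rot p i)) = (\<Sum>i<p. h i :: nat)"
  by (rule sum.reindex_bij_betw[OF bij_betw_rot])

text \<open>If the signs differed, the first position \<open>b\<close> of \<open>Y\<close> would
  precede the first position \<open>a\<close> of \<open>X\<close> by at least \<open>s - 1\<close>.
  Then \<open>b\<close> could be added to any stable set in the class of \<open>X\<close> with the
  sign of \<open>b\<close>, against the equality of the stability numbers.\<close>

lemma first_element_stable:
  assumes Y: "Y \<in> faces p n" and XY: "X \<subseteq>\<^sub>m Y" and "X \<noteq> Map.empty"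
    and eq: "\<And>i. stab_num s (sign_class X i) = stab_num s (sign_class Y i)"
    and m: "(LEAST l. l \<in> dom X) mod (s - 1) = (LEAST l. l \<in> dom Y) mod (s - 1)"
    and s: "s \<ge> 2"
  shows "lead X = lead Y"
proof (rule ccontr)
  assume ne: "lead X \<noteq> lead Y"
  define a where "a = (LEAST l. l \<in> dom X)"
  define b where "b = (LEAST l. l \<in> dom Y)"
  have "Y \<noteq> Map.empty" using XY \<open>X \<noteq> Map.empty\<close> by (metis map_le_antisym map_le_empty)
  have Xa: "X a = Some (lead X)" and Yb: "Y b = Some (lead Y)"
    using lead_in \<open>X \<noteq> Map.empty\<close> \<open>Y \<noteq> Map.empty\<close> by (auto simp: a_def b_def)
  have Ya: "Y a = Some (lead X)" using XY Xa unfolding map_le_def by (metis domI)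
  then have "b \<le> a" unfolding b_def by (intro Least_le) auto
  moreover have "a \<noteq> b" using Ya Yb ne by auto
  ultimately have "b < a" by simp
  moreover have "s - 1 dvd a - b"
    using m \<open>b \<le> a\<close> unfolding a_def b_def by (metis mod_eq_dvd_iff_nat)
  ultimately have ab: "b + (s - 1) \<le> a" using dvd_imp_le[of "s - 1" "a - b"] by simp
  have "stab_num s (sign_class X (lead Y)) < stab_num s (sign_class Y (lead Y))"
  proof (rule stab_num_insert[where a = "Suc b"])
    show "finite (sign_class Y (lead Y))" by (rule finite_sign_class[OF Y])
    show "Suc b \<in> sign_class Y (lead Y)" using Yb by (simp add: sign_class_def)
    show "sign_class X (lead Y) \<subseteq> sign_class Y (lead Y)" by (rule sign_class_mono[OF XY])
    show "s > 0" using s by simp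
    fix c assume "c \<in> sign_class X (lead Y)"
    then obtain l where l: "c = Suc l" "X l = Some (lead Y)" by (auto simp: sign_class_def)
    have "a \<le> l" unfolding a_def by (rule Least_le) (use l(2) in auto)
    \<comment> \<open>As \<open>a\<close> has the other sign, \<open>l\<close> lies strictly beyond
      it. This extra unit turns the gap \<open>s - 1\<close> into the required
      \<open>s\<close>.\<close>
    moreover have "a \<noteq> l" using l(2) Xa ne by auto
    ultimately show "Suc b + s \<le> c" using ab l(1) s by simp
  qed
  then show False using eq by simp
qed

lemma stab_num_ge_obtain:
  assumes "finite A" "k \<le> stab_num s A"
  obtains S where "S \<subseteq> A" "almost_stable s S" "card S = k"
proof -
  obtain T where T: "T \<subseteq> A" "almost_stable s T" "card T = stab_num s A"
    using stab_num_witness[OF assms(1)] by blast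
  then obtain S where "S \<subseteq> T" "card S = k"
    using obtain_subset_with_card_n[of k T] assms(2) by auto
  then show ?thesis using that T almost_stable_subset by (metis subset_trans)
qed

definition class_colors ::
  "nat \<Rightarrow> nat \<Rightarrow> nat \<Rightarrow> (nat set \<Rightarrow> nat) \<Rightarrow> (nat \<rightharpoonup> nat) \<Rightarrow> nat \<Rightarrow> nat set" where
  "class_colors n k s f Y i = f ` {S \<in> KG_vertices n k s. S \<subseteq> sign_class Y i}"

text \<open>A color present in all classes would give one vertex of that color in each. The classes
  are disjoint and \<open>k \<ge> 1\<close> makes the vertices nonempty, hence distinct, so they
  form a monochromatic edge.\<close>

lemma class_colors_no_common:
  assumes "proper_coloring (KG_vertices n k s) (KG_edges p n k s) C f" "k \<ge> 1"
  shows "\<exists>i<p. c \<notin> class_colors n k s f Y i"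
proof (rule ccontr)
  assume "\<not> ?thesis"
  then have "\<forall>i<p. \<exists>S. S \<in> KG_vertices n k s \<and> S \<subseteq> sign_class Y i \<and> f S = c"
    unfolding class_colors_def by (auto simp: image_iff)
  then obtain S where S: "\<And>i. i < p \<Longrightarrow> S i \<in> KG_vertices n k s \<and> S i \<subseteq> sign_class Y i \<and> f (S i) = c"
    by metis
  have dj: "S i \<inter> S j = {}" if "i < p" "j < p" "i \<noteq> j" for i j
    using S[of i] S[of j] sign_class_disjoint[of i j Y] that by blast
  have ne: "S i \<noteq> {}" if "i < p" for i
    using S[OF that] \<open>k \<ge> 1\<close> by (auto simp: KG_vertices_def)
  have "inj_on S {..<p}"
    by (rule inj_onI, rule ccontr) (use dj ne in fastforce)
  then have "card (S ` {..<p}) = p" by (simp add: card_image)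
  moreover have "pairwise disjnt (S ` {..<p})"
    unfolding pairwise_def disjnt_def using dj by (metis imageE lessThan_iff)
  moreover have "S ` {..<p} \<subseteq> KG_vertices n k s" using S by auto
  ultimately have "S ` {..<p} \<in> KG_edges p n k s" by (simp add: KG_edges_def)
  moreover have "monochromatic f (S ` {..<p})" unfolding monochromatic_def using S by auto
  ultimately show False using assms(1) by (simp add: proper_coloring_def)
qed

text \<open>The blocks hold the sums of stability numbers, the nonzero residues modulo
  \<open>s - 1\<close> for equal stability numbers (whose sum is a multiple of \<open>p\<close>),
  and the color counts.\<close>

lemma card_label_set:
  fixes p k s c :: nat
  assumes "s \<ge> 2" "k \<ge> 1"
  defines "A \<equiv> {0} \<times> {1..p * (k - 1)} \<times> {0} \<union> {0} \<times> ((*) p ` {1..k - 1}) \<times> {1..<s - 1}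
      \<union> {1::nat} \<times> {1..c} \<times> {0::nat}"
  shows "finite A" "card A \<le> p * (k - 1) + (k - 1) * (s - 2) + c"
proof -
  show "finite A" by (simp add: A_def)
  have "card ((*) p ` {1..k - 1}) \<le> k - 1"
    using card_image_le[of "{1..k - 1}" "(*) p"] by simp
  then have "card ((*) p ` {1..k - 1}) * (s - 2) \<le> (k - 1) * (s - 2)" by (rule mult_right_mono) simp
  moreover have "card A \<le> card ({0::nat} \<times> {1..p * (k - 1)} \<times> {0::nat}) + 
      card ({0::nat} \<times> ((*) p ` {1..k - 1}) \<times> {1..<s - 1}) + card ({1::nat} \<times> {1..c} \<times> {0::nat})"
    unfolding A_def by (meson add_right_mono card_Un_le order_trans)
  moreover have "card ({0::nat} \<times> {1..p * (k - 1)} \<times> {0::nat}) = p * (k - 1)"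
    "card ({0::nat} \<times> ((*) p ` {1..k - 1}) \<times> {1..<s - 1}) = card ((*) p ` {1..k - 1}) * (s - 2)"
    "card ({1::nat} \<times> {1..c} \<times> {0::nat}) = c"
    by (simp_all add: card_cartesian_product numeral_2_eq_2)
  ultimately show "card A \<le> p * (k - 1) + (k - 1) * (s - 2) + c" by linarith
qed

section \<open>The labelling obtained from a proper coloring\<close>

lemma proper_coloring_bound:
  assumes prime: "prime p" and k: "k \<ge> 1" and s: "s \<ge> 2"
    and col: "proper_coloring (KG_vertices n k s) (KG_edges p n k s) C f"
  shows "n \<le> p * (k - 1) + (k - 1) * (s - 2) + C * (p - 1)"
proof -
  have p: "p \<ge> 2" using prime by (rule prime_ge_2_nat)
  obtain h :: "(nat \<Rightarrow> nat) \<Rightarrow> nat" where h: "\<And>u v. (\<And>i. v (rot p i) = u i) \<Longrightarrow> 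
      \<not> (\<exists>c. \<forall>i<p. u i = c) \<Longrightarrow> h u < p \<and> h v = rot p (h u)"
    using equivariant_choice[OF prime] by blast
  obtain h' :: "(nat \<Rightarrow> nat set) \<Rightarrow> nat" where h': "\<And>u v. (\<And>i. v (rot p i) = u i) \<Longrightarrow> 
      \<not> (\<exists>c. \<forall>i<p. u i = c) \<Longrightarrow> h' u < p \<and> h' v = rot p (h' u)"
    using equivariant_choice[OF prime] by blast
  define g where "g Y i = stab_num s (sign_class Y i)" for Y i
  define D where "D = class_colors n k s f"
  define bad where "bad Y \<longleftrightarrow> (\<forall>i<p. g Y i < k)" for Y
  define const where "const Y \<longleftrightarrow> (\<exists>c. \<forall>i<p. g Y i = c)" for Y
  \<comment> \<open>The leading \<open>0\<close> or \<open>1\<close> separates the two regimes.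
    Residue \<open>0\<close> shares its label with the nonconstant case of the same sum; this is
    harmless, as comparable vectors with equal sums have equal \<open>g\<close>.\<close>
  define label where "label Y = (if bad Y then (0::nat, \<Sum>i<p. g Y i, 
      if const Y then (LEAST l. l \<in> dom Y) mod (s - 1) else 0)
    else (1, \<Sum>i<p. card (D Y i), 0))" for Y
  define sign where "sign Y = (if bad Y then if const Y then lead Y else h (g Y) else h' (D Y))" for Y
  define A where "A = {0} \<times> {1..p * (k - 1)} \<times> {0} \<union> {0} \<times> ((*) p ` {1..k - 1}) \<times> {1..<s - 1}
      \<union> {1::nat} \<times> {1..C * (p - 1)} \<times> {0::nat}"
  have A: "finite A" "card A \<le> p * (k - 1) + (k - 1) * (s - 2) + C * (p - 1)"
    unfolding A_def by (rule card_label_set[OF s k])+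
  obtain e where e: "bij_betw e A {..<card A}"
    using ex_bij_betw_finite_nat[OF A(1)] by (auto simp: atLeast0LessThan)

  have D_sub: "D Y i \<subseteq> {..<C}" for Y i
    using col by (auto simp: D_def class_colors_def proper_coloring_def)
  then have D_fin: "finite (D Y i)" for Y i using finite_subset by blast
  \<comment> \<open>The choice functions see arguments on all of \<open>nat\<close>, so values
    beyond the signs must be fixed as well; the same holds for \<open>g\<close>.\<close>
  have D_ge: "D Y i = {}" if "Y \<in> faces p n" "i \<ge> p" for Y i
    using sign_class_ge[OF that] k by (auto simp: D_def class_colors_def KG_vertices_def)
  have g_ge: "g Y i = 0" if "Y \<in> faces p n" "i \<ge> p" for Y i
    using sign_class_ge[OF that] by (simp add: g_def)
  have not_all: "\<exists>i<p. c \<notin> D Y i" for c Y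
    unfolding D_def by (rule class_colors_no_common[OF col k])
  have D_ne: "\<exists>i<p. D Y i \<noteq> {}" if Y: "Y \<in> faces p n" and "\<not> bad Y" for Y
  proof -
    obtain i where i: "i < p" "k \<le> g Y i" using \<open>\<not> bad Y\<close> by (auto simp: bad_def not_less)
    obtain S where S: "S \<subseteq> sign_class Y i" "almost_stable s S" "card S = k"
      using i(2) stab_num_ge_obtain[OF finite_sign_class[OF Y, of i]] unfolding g_def by blast
    then have "S \<in> KG_vertices n k s"
      using sign_class_faces[OF Y, of i] by (auto simp: KG_vertices_def)
    then have "f S \<in> D Y i" using S(1) by (auto simp: D_def class_colors_def)
    then show ?thesis using i(1) by blast
  qed
  \<comment> \<open>Some class contains a color, and that color is missing from another
    class.\<close>
  have D_nonconst: "\<not> (\<exists>c. \<forall>i<p. D Y i = c)" if "Y \<in> faces p n" "\<not> bad Y" for Y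
    using D_ne[OF that] not_all[of _ Y] by (metis all_not_in_conv)

  have g_shift: "g (shift p Y) (rot p i) = g Y i" for Y i
    by (simp add: g_def sign_class_shift)
  have D_shift: "D (shift p Y) (rot p i) = D Y i" for Y i
    by (simp add: D_def class_colors_def sign_class_shift)
  have bad_shift: "bad (shift p Y) = bad Y" for Y
    using all_rot_iff[of p "\<lambda>i. g (shift p Y) i < k"] by (simp add: bad_def g_shift)
  have const_shift: "const (shift p Y) = const Y" for Y
    using all_rot_iff[of p "\<lambda>i. g (shift p Y) i = c" for c] by (simp add: const_def g_shift)
  have sum_shift: "(\<Sum>i<p. g (shift p Y) i) = (\<Sum>i<p. g Y i)" for Y
    using sum_rot[of "g (shift p Y)" p] by (simp add: g_shift)
  have sum_shift': "(\<Sum>i<p. card (D (shift p Y) i)) = (\<Sum>i<p. card (D Y i))" for Y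
    using sum_rot[of "\<lambda>i. card (D (shift p Y) i)" p] by (simp add: D_shift)
  have label_shift: "label (shift p Y) = label Y" for Y
    by (simp add: label_def bad_shift const_shift sum_shift sum_shift')

  have sign_ok: "sign Y < p \<and> sign (shift p Y) = rot p (sign Y)" 
    if Y: "Y \<in> faces p n" "Y \<noteq> Map.empty" for Y
  proof -
    consider "bad Y" "const Y" | "bad Y" "\<not> const Y" | "\<not> bad Y" by blast
    then show ?thesis
    proof cases
      case 1
      then show ?thesis
        using lead_less[OF Y] lead_shift[OF Y(2)] by (simp add: sign_def bad_shift const_shift)
    next
      case 2
      have "h (g Y) < p \<and> h (g (shift p Y)) = rot p (h (g Y))"
        by (rule h) (use 2(2) g_shift in \<open>simp_all add: const_def\<close>)
      with 2 show ?thesis by (simp add: sign_def bad_shift const_shift)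
    next
      case 3
      then show ?thesis
        using h'[of "D (shift p Y)" "D Y"] D_shift D_nonconst[OF Y(1)] by (simp add: sign_def bad_shift)
    qed
  qed

  have label_in: "label Y \<in> A" if Y: "Y \<in> faces p n" "Y \<noteq> Map.empty" for Y
  proof (cases "bad Y")
    case True
    \<comment> \<open>The first occupied position alone is a stable set, so the value
      \<open>0\<close> needs no label.\<close>
    have pos: "(\<Sum>i<p. g Y i) \<ge> 1"
    proof -
      have "Suc (LEAST l. l \<in> dom Y) \<in> sign_class Y (lead Y)"
        using lead_in[OF Y(2)] by (simp add: sign_class_def)
      then have "1 \<le> g Y (lead Y)"
        unfolding g_def by (rule stab_num_pos[OF finite_sign_class[OF Y(1)]])
      also have "\<dots> \<le> (\<Sum>i<p. g Y i)"
        using lead_less[OF Y] by (intro member_le_sum) auto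
      finally show ?thesis .
    qed
    have "g Y i \<le> k - 1" if "i < p" for i using True that by (force simp: bad_def)
    then have le: "(\<Sum>i<p. g Y i) \<le> p * (k - 1)"
      using sum_bounded_above[of "{..<p}" "g Y" "k - 1"] by simp
    show ?thesis
    proof (cases "const Y \<and> (LEAST l. l \<in> dom Y) mod (s - 1) \<noteq> 0")
      case False
      then have "label Y = (0, \<Sum>i<p. g Y i, 0)" using True by (auto simp: label_def)
      then show ?thesis using pos le by (simp add: A_def)
    next
      case c: True
      then obtain c where c': "\<forall>i<p. g Y i = c" by (auto simp: const_def)
      then have "(\<Sum>i<p. g Y i) = p * c" by simp
      moreover have "c \<le> k - 1" using True c' p by (force simp: bad_def)
      moreover have "c \<ge> 1" using pos \<open>(\<Sum>i<p. g Y i) = p * c\<close> by (cases c) auto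
      moreover have "(LEAST l. l \<in> dom Y) mod (s - 1) < s - 1" using s by simp
      ultimately show ?thesis
        using c True by (auto simp: label_def A_def)
    qed
  next
    case False
    \<comment> \<open>Double counting by colors: each of the \<open>C\<close> colors occurs in at
      most \<open>p - 1\<close> classes.\<close>
    have "(\<Sum>i<p. card (D Y i)) = (\<Sum>i<p. \<Sum>c<C. if c \<in> D Y i then 1 else 0)"
    proof (rule sum.cong[OF refl])
      fix i
      have "(\<Sum>c<C. if c \<in> D Y i then 1 else 0 :: nat) = card ({..<C} \<inter> D Y i)"
        by (simp add: sum.If_cases)
      also have "{..<C} \<inter> D Y i = D Y i" using D_sub[of Y i] by blast
      finally show "card (D Y i) = (\<Sum>c<C. if c \<in> D Y i then 1 else 0)" by simp
    qed
    also have "\<dots> = (\<Sum>c<C. \<Sum>i<p. if c \<in> D Y i then 1 else 0)" by (rule sum.swap)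
    also have "\<dots> \<le> (\<Sum>c<C. p - 1)"
    proof (rule sum_mono)
      fix c
      obtain j where j: "j < p" "c \<notin> D Y j" using not_all by blast
      have "(\<Sum>i<p. if c \<in> D Y i then 1 else 0 :: nat) = card ({..<p} \<inter> {i. c \<in> D Y i})"
        by (simp add: sum.If_cases)
      also have "\<dots> \<le> card ({..<p} - {j})" using j by (intro card_mono) auto
      finally show "(\<Sum>i<p. if c \<in> D Y i then 1 else 0 :: nat) \<le> p - 1" using j by simp
    qed
    finally have le: "(\<Sum>i<p. card (D Y i)) \<le> C * (p - 1)" by simp
    obtain i where i: "i < p" "D Y i \<noteq> {}" using D_ne[OF Y(1) False] by blast
    then have "1 \<le> card (D Y i)" using D_fin[of Y i] by (simp add: Suc_le_eq card_gt_0_iff)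
    also have "\<dots> \<le> (\<Sum>i<p. card (D Y i))" using i(1) by (intro member_le_sum) auto
    finally show ?thesis using le False by (simp add: label_def A_def)
  qed

  have label_sign: "sign X = sign Y"
    if X: "X \<in> faces p n" "X \<noteq> Map.empty" and Y: "Y \<in> faces p n" and XY: "X \<subseteq>\<^sub>m Y"
      and eq: "label X = label Y" for X Y
  proof (cases "bad Y")
    case True
    then have bX: "bad X" and sums: "(\<Sum>i<p. g X i) = (\<Sum>i<p. g Y i)"
      using eq by (auto simp: label_def split: if_splits)
    have le: "g X i \<le> g Y i" for i
      unfolding g_def by (rule stab_num_mono[OF finite_sign_class[OF Y] sign_class_mono[OF XY]])
    \<comment> \<open>Termwise inequality together with equal sums forces termwise equality, so any
      sign computed from \<open>g\<close> alone agrees.\<close>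
    have gi: "g X i = g Y i" for i
    proof (cases "i < p")
      case True
      then show ?thesis using sum_mono_inv[OF sums] le by simp
    next
      case False
      then show ?thesis using g_ge X(1) Y by simp
    qed
    then have gXY: "g X = g Y" by (simp add: fun_eq_iff)
    then have cXY: "const X = const Y" by (simp add: const_def)
    show ?thesis
    proof (cases "const Y")
      case c: True
      have "lead X = lead Y"
      proof (rule first_element_stable[OF Y XY X(2) _ _ s])
        show "stab_num s (sign_class X i) = stab_num s (sign_class Y i)" for i
          using gi by (simp add: g_def)
        show "(LEAST l. l \<in> dom X) mod (s - 1) = (LEAST l. l \<in> dom Y) mod (s - 1)"
          using eq True bX c cXY by (simp add: label_def)
      qed
      then show ?thesis using True bX c cXY by (simp add: sign_def)
    next
      case False
      then show ?thesis using True bX cXY gXY by (simp add: sign_def)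
    qed
  next
    case False
    then have bX: "\<not> bad X" and sums: "(\<Sum>i<p. card (D X i)) = (\<Sum>i<p. card (D Y i))"
      using eq by (auto simp: label_def split: if_splits)
    have sub: "D X i \<subseteq> D Y i" for i
      using sign_class_mono[OF XY, of i] unfolding D_def class_colors_def by blast
    have "D X i = D Y i" for i
    proof (cases "i < p")
      case True
      then have "card (D X i) = card (D Y i)"
        using sum_mono_inv[OF sums] card_mono[OF D_fin sub] by simp
      then show ?thesis using card_subset_eq[OF D_fin sub] by blast
    next
      case False
      then show ?thesis using D_ge X(1) Y by simp
    qed
    then have "D X = D Y" by (simp add: fun_eq_iff)
    then show ?thesis using False bX by (simp add: sign_def)
  qed

  have "equivariant_labelling p n (card A) (e \<circ> label) sign"
    unfolding equivariant_labelling_def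
  proof (intro conjI ballI impI)
    fix Y assume Y: "Y \<in> faces p n" "Y \<noteq> Map.empty"
    show "(e \<circ> label) Y < card A" using label_in[OF Y] e by (auto simp: bij_betw_def)
    show "(e \<circ> label) (shift p Y) = (e \<circ> label) Y" by (simp add: label_shift)
    show "sign Y < p" "sign (shift p Y) = rot p (sign Y)" using sign_ok[OF Y] by auto
  next
    fix X Y assume X: "X \<in> faces p n" "X \<noteq> Map.empty" and Y: "Y \<in> faces p n" and XY: "X \<subseteq>\<^sub>m Y"
      and eq: "(e \<circ> label) X = (e \<circ> label) Y"
    have "Y \<noteq> Map.empty" using X(2) XY by (metis map_le_antisym map_le_empty)
    then have "label X = label Y"
      using eq label_in[OF X] label_in[OF Y] e by (auto simp: bij_betw_def inj_on_def)
    then show "sign X = sign Y" by (rule label_sign[OF X Y XY])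
  qed
  then have "n \<le> card A" by (rule Zp_Tucker[OF p])
  then show ?thesis using A(2) by simp
qed

section \<open>From the counting bound to the chromatic number\<close>

theorem theorem2p3:
  fixes p n k s :: nat
  assumes "prime p" and "n \<ge> 1" and "k \<ge> 1" and "s \<ge> 2"
    and "n \<ge> (p + s - 2) * (k - 1) + max p s"
  shows "int (chromatic_number (KG_vertices n k s) (KG_edges p n k s))
           \<ge> \<lceil>(real n - (real p + real s - 2) * (real k - 1)) / (real p - 1)\<rceil>"
proof -
  let ?C = "chromatic_number (KG_vertices n k s) (KG_edges p n k s)"
  have p: "p \<ge> 2" using assms(1) by (rule prime_ge_2_nat)
  \<comment> \<open>The minimum is attained because a proper coloring exists for
    \<open>p \<ge> 2\<close>.\<close>
  have "\<exists>f. proper_coloring (KG_vertices n k s) (KG_edges p n k s) ?C f"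
    unfolding chromatic_number_def by (rule LeastI_ex[OF KG_properly_colorable[OF p]])
  then have "n \<le> p * (k - 1) + (k - 1) * (s - 2) + ?C * (p - 1)"
    using proper_coloring_bound[OF assms(1,3,4)] by blast
  then have "real n \<le> real (p * (k - 1) + (k - 1) * (s - 2) + ?C * (p - 1))"
    by (rule of_nat_mono)
  also have "\<dots> = (real p + real s - 2) * (real k - 1) + real ?C * (real p - 1)"
  proof -
    \<comment> \<open>The natural subtractions are exact here, so both summands with factor
      \<open>k - 1\<close> combine to \<open>p + s - 2\<close>.\<close>
    have "real (p - 1) = real p - 1" "real (k - 1) = real k - 1" "real (s - 2) = real s - 2"
      using p assms(3,4) by (simp_all add: of_nat_diff)
    then show ?thesis by (simp only: of_nat_add of_nat_mult) (simp add: algebra_simps)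
  qed
  finally have "(real n - (real p + real s - 2) * (real k - 1)) / (real p - 1) \<le> real ?C"
    using p by (simp add: field_simps)
  then show ?thesis by (simp add: ceiling_le_iff)
qed

end
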